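(* Let $k \geq 1$ and $d \geq 1$ be integers with $d \leq 2k+1$. Then $\mathsf{s}_{2k}'(\mathbb{Z}_2^d) = \mathsf{s}_{2k}(\mathbb{Z}_2^d)-1$ in each of the following cases: \begin{itemize} \item $d=2k-1$; \item $d=2k-3$ and $k$ is even; \item $d \leq 2k-5$ and $d$ is odd. \end{itemize} In all other cases (with $d \leq 2k+1$), $\mathsf{s}_{2k}'(\mathbb{Z}_2^d) = \mathsf{s}_{2k}(\mathbb{Z}_2^d)$.
   Context: $\mathbb{Z}_2^d$ denotes the direct sum of $d$ copies of the cyclic group of order $2$, written additively. A sequence of length $s$ over a finite abelian group $G$ is a list $g_1,\ldots,g_s$ of elements of $G$, with repetitions allowed. A sequence is zero-sum if the sum of all its terms is $0$. A subsequence of length $r$ is given by a set of $r$ distinct indices $A \subseteq \{1,\ldots,s\}$ (not necessarily consecutive); it is zero-sum if $\sum_{i\in A} g_i = 0$. A zero-sum sequence is regarded as a subsequence of itself. Let $G$ be a finite abelian group and let $r$ be a positive multiple of its exponent $\exp(G)$ (the least common multiple of the orders of its elements; $\exp(\mathbb{Z}_2^d)=2$). The generalized Erdős–Ginzburg–Ziv constant $\mathsf{s}_r(G)$ is the smallest integer $s$ such that every sequence of length $s$ over $G$ has a zero-sum subsequence of length $r$. The modified Erdős–Ginzburg–Ziv constant $\mathsf{s}_r'(G)$ is the smallest integer $s$ such that every zero-sum sequence over $G$ of length at least $s$ has a zero-sum subsequence of length $r$. *)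

theory Defs
  imports "HOL-Algebra.Algebra"
begin

text \<open>
  Groups are HOL-Algebra structures, so the additive notation for an abelian group is rendered
  multiplicatively: a sum of terms is \<^const>\<open>finprod\<close> and zero is \<open>\<one>\<^bsub>G\<^esub>\<close>. A sequence over \<open>G\<close> is a
  list, and a subsequence is given by its set of positions.
\<close>

definition seq_over :: "('a, 'b) monoid_scheme \<Rightarrow> 'a list \<Rightarrow> bool" where
  "seq_over G xs \<longleftrightarrow> set xs \<subseteq> carrier G"

definition zero_sum_on :: "('a, 'b) monoid_scheme \<Rightarrow> 'a list \<Rightarrow> nat set \<Rightarrow> bool" where
  "zero_sum_on G xs A \<longleftrightarrow> (\<Otimes>\<^bsub>G\<^esub>i\<in>A. xs ! i) = \<one>\<^bsub>G\<^esub>"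

definition zero_sum_seq :: "('a, 'b) monoid_scheme \<Rightarrow> 'a list \<Rightarrow> bool" where
  "zero_sum_seq G xs \<longleftrightarrow> zero_sum_on G xs {..<length xs}"

definition has_zero_sum_subseq :: "('a, 'b) monoid_scheme \<Rightarrow> nat \<Rightarrow> 'a list \<Rightarrow> bool" where
  "has_zero_sum_subseq G r xs \<longleftrightarrow> (\<exists>A \<subseteq> {..<length xs}. card A = r \<and> zero_sum_on G xs A)"

text \<open>
  The two constants are meaningful for a finite abelian group \<open>G\<close> and a positive multiple \<open>r\<close> of
  its exponent; then the minima below exist, see \<open>egz_exists\<close> and \<open>egz_mod_exists\<close>.
\<close>

definition egz :: "nat \<Rightarrow> ('a, 'b) monoid_scheme \<Rightarrow> nat" where
  "egz r G = (LEAST s. \<forall>xs. seq_over G xs \<and> length xs = s \<longrightarrow> has_zero_sum_subseq G r xs)"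

definition egz_mod :: "nat \<Rightarrow> ('a, 'b) monoid_scheme \<Rightarrow> nat" where
  "egz_mod r G = (LEAST s. \<forall>xs. seq_over G xs \<and> zero_sum_seq G xs \<and> length xs \<ge> s
                                  \<longrightarrow> has_zero_sum_subseq G r xs)"

definition Z2_pow :: "nat \<Rightarrow> (nat \<Rightarrow> int) monoid" where
  "Z2_pow d = sum_group {..<d} (\<lambda>_. integer_mod_group 2)"

lemma has_zero_sum_subseq_long:
  assumes G: "comm_group G" "finite (carrier G)" and r: "r > 0"
    and ex: "\<And>x. x \<in> carrier G \<Longrightarrow> x [^]\<^bsub>G\<^esub> r = \<one>\<^bsub>G\<^esub>"
    and xs: "seq_over G xs" "length xs \<ge> card (carrier G) * r"
  shows "has_zero_sum_subseq G r xs"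
proof -
  interpret comm_group G by (rule G(1))
  let ?F = "\<lambda>x. {i. i < length xs \<and> xs ! i = x}"
  have "\<exists>x\<in>carrier G. card (?F x) \<ge> r"
  proof (rule ccontr)
    assume "\<not> ?thesis"
    then have lt: "card (?F x) < r" if "x \<in> carrier G" for x
      using that by (auto simp: not_le)
    have eq: "{..<length xs} = (\<Union>x\<in>carrier G. ?F x)"
      using xs(1) by (auto simp: seq_over_def subset_iff)
    then have "length xs = card (\<Union>x\<in>carrier G. ?F x)"
      by (simp only: eq[symmetric] card_lessThan)
    also have "\<dots> \<le> (\<Sum>x\<in>carrier G. card (?F x))"
      by (rule card_UN_le[OF G(2)])
    also have "\<dots> < (\<Sum>x\<in>carrier G. r)"
      by (rule sum_strict_mono[OF G(2)]) (use lt in auto)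
    finally show False using xs(2) by simp
  qed
  then obtain x where x: "x \<in> carrier G" "card (?F x) \<ge> r" by blast
  obtain A where A: "A \<subseteq> ?F x" "card A = r"
    by (rule obtain_subset_with_card_n[OF x(2)])
  have "(\<Otimes>\<^bsub>G\<^esub>i\<in>A. xs ! i) = (\<Otimes>\<^bsub>G\<^esub>i\<in>A. x)"
    by (rule finprod_cong') (use A x in auto)
  also have "\<dots> = \<one>\<^bsub>G\<^esub>" using x A ex by (simp add: finprod_const)
  finally have "zero_sum_on G xs A" by (simp add: zero_sum_on_def)
  moreover have "A \<subseteq> {..<length xs}" using A(1) by auto
  ultimately show ?thesis
    unfolding has_zero_sum_subseq_def using A(2) by blast
qed

lemma egz_exists:
  assumes "comm_group G" "finite (carrier G)" "r > 0"
    and "\<And>x. x \<in> carrier G \<Longrightarrow> x [^]\<^bsub>G\<^esub> r = \<one>\<^bsub>G\<^esub>"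
  shows "\<exists>s. \<forall>xs. seq_over G xs \<and> length xs = s \<longrightarrow> has_zero_sum_subseq G r xs"
  by (rule exI[of _ "card (carrier G) * r"]) (use has_zero_sum_subseq_long[OF assms] in simp)

lemma egz_mod_exists:
  assumes "comm_group G" "finite (carrier G)" "r > 0"
    and "\<And>x. x \<in> carrier G \<Longrightarrow> x [^]\<^bsub>G\<^esub> r = \<one>\<^bsub>G\<^esub>"
  shows "\<exists>s. \<forall>xs. seq_over G xs \<and> zero_sum_seq G xs \<and> length xs \<ge> s
                 \<longrightarrow> has_zero_sum_subseq G r xs"
  by (rule exI[of _ "card (carrier G) * r"]) (use has_zero_sum_subseq_long[OF assms] in simp)

lemma carrier_Z2_pow: "carrier (Z2_pow d) = {..<d} \<rightarrow>\<^sub>E {0, 1}"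
proof -
  have "{0..<2::int} = {0, 1}" by auto
  then show ?thesis
    by (simp add: Z2_pow_def carrier_sum_group carrier_integer_mod_group)
qed

lemma finite_carrier_Z2_pow: "finite (carrier (Z2_pow d))"
  by (simp add: carrier_Z2_pow finite_PiE)

lemma card_carrier_Z2_pow: "card (carrier (Z2_pow d)) = 2 ^ d"
  by (simp add: carrier_Z2_pow card_PiE numeral_2_eq_2)

lemma comm_group_Z2_pow: "comm_group (Z2_pow d)"
proof -
  have "group (Z2_pow d)" by (simp add: Z2_pow_def)
  then show ?thesis
    by (rule group.group_comm_groupI) (simp add: Z2_pow_def add.commute)
qed

lemma Z2_pow_pow_even:
  fixes k :: nat
  assumes x: "x \<in> carrier (Z2_pow d)"
  shows "x [^]\<^bsub>Z2_pow d\<^esub> (2 * k) = \<one>\<^bsub>Z2_pow d\<^esub>"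
proof -
  interpret comm_group "Z2_pow d" by (rule comm_group_Z2_pow)
  have mult: "x \<otimes>\<^bsub>Z2_pow d\<^esub> x = (\<lambda>i\<in>{..<d}. (x i + x i) mod 2)"
    by (simp add: Z2_pow_def)
  have one: "\<one>\<^bsub>Z2_pow d\<^esub> = (\<lambda>i\<in>{..<d}. 0)"
    by (simp add: Z2_pow_def)
  have "x \<otimes>\<^bsub>Z2_pow d\<^esub> x = \<one>\<^bsub>Z2_pow d\<^esub>"
    unfolding mult one by (rule restrict_ext) presburger
  moreover have "x [^]\<^bsub>Z2_pow d\<^esub> (2::nat) = x \<otimes>\<^bsub>Z2_pow d\<^esub> x"
    using x by (simp add: numeral_2_eq_2)
  ultimately have "(x [^]\<^bsub>Z2_pow d\<^esub> (2::nat)) [^]\<^bsub>Z2_pow d\<^esub> k = \<one>\<^bsub>Z2_pow d\<^esub>"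
    by simp
  then show ?thesis
    by (simp only: nat_pow_pow[OF x])
qed

end

theory Submission
  imports Defs
begin

text \<open>
  Record a sequence of length \<open>n\<close> over \<open>\<int>\<^sub>2\<^sup>d\<close> by the \<open>d\<close> sets \<open>H j\<close> of
  positions whose term has \<open>j\<close>-th coordinate one; a set of positions is zero-sum if and only
  if it meets every \<open>H j\<close> evenly. Only sets of even size matter, so let \<open>E\<close> be the binary code
  spanned by the \<open>H j\<close> and the set \<open>I\<close> of all positions. It has at most \<open>2 ^ (d + 1)\<close> words,
  and the zero-sum sets of even size form its dual code. Call the sequence bad if it has no
  zero-sum subsequence of length \<open>2 * k\<close>. The generalized constant asks how long a code \<open>E\<close> of
  this size can be when its dual has no word of weight \<open>2 * k\<close>. For even \<open>n\<close>, the sequence is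
  zero-sum if and only if \<open>I\<close> is itself a dual word, and then the dual is closed under
  complements. If \<open>n\<close> is odd, adding a suitable constant to all terms makes the whole sequence
  zero-sum without affecting its zero-sum sets of even size (\<open>not_hits_odd_length\<close>). So the
  two constants differ by at most one, and they differ precisely when the longest bad
  sequences have even length and none of them is zero-sum.

  All upper bounds come from one structure theorem (\<open>midweight_free\<close>): if \<open>I\<close> has \<open>4 * k + 2\<close>
  positions, \<open>E\<close> has at most \<open>2 ^ (2 * k + 2)\<close> words and no dual word has weight \<open>2 * k\<close>, then
  \<open>k\<close> is odd, all dual weights are divisible by four, and no position is avoided by all dual
  words. Sequences of other lengths are padded or shortened to \<open>4 * k + 2\<close> positions. For
  \<open>d = 2 * k + 1\<close> and odd \<open>k\<close> the dual code is forced to be doubly even, hence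
  self-orthogonal, and so it cannot be as large as it has to be. For a zero-sum sequence one
  applies these results to a smaller weight \<open>2 * k'\<close> and takes the complement of the zero-sum
  set; for length \<open>4 * k - 2\<close> the whole sequence would be a dual word of weight not divisible
  by four.

  To prove the structure theorem, join the positions into \<open>2 * k + 1\<close> pairs. By a character
  sum, a dual word of given shape with respect to the pairs exists unless a word of \<open>E\<close> that
  is a union of pairs obstructs it (\<open>exists_matched_shift\<close>). Choose the pairing for which the
  fewest even words of \<open>E\<close> are unions of pairs. If a nontrivial one remains, then re-pairing
  two pairs cannot lower the number, and this forces \<open>E\<close> to be large (\<open>card_ge_if_matched\<close>).
  Hence, in the main case, only the trivial words are unions of pairs. As no dual word has
  weight \<open>2 * k\<close>, there is for each pair \<open>r\<close> a word \<open>y r\<close> of \<open>E\<close> that splits \<open>r\<close> and no other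
  pair, and contains an odd number of pairs. Draw an arc from \<open>r\<close> to \<open>s\<close> if \<open>y r\<close> contains the
  pair \<open>s\<close>. Dual words correspond to odd sets \<open>U\<close> of vertices of this digraph, and the weight
  is determined by the number of vertices of odd out-degree in the subgraph induced on \<open>U\<close>.
  The missing weight thus forbids one value of this number for every \<open>U\<close>. As all out-degrees
  are odd, the sets with three and five vertices already force each triple of vertices to span
  an odd number of arcs (\<open>not_unsep\<close>), as in a tournament, and counting arcs modulo two gives
  the theorem.
\<close>

section \<open>Binary codes and their duals\<close>

abbreviation sdiff :: "'a set \<Rightarrow> 'a set \<Rightarrow> 'a set" (infixl "\<triangle>" 65) where
  "A \<triangle> B \<equiv> (A - B) \<union> (B - A)"

lemma sdiff_cancel: "A \<triangle> B \<triangle> B = A"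
  by auto

lemma even_card_inter_sdiff:
  assumes "finite A"
  shows "even (card (A \<inter> (x \<triangle> y))) \<longleftrightarrow> (even (card (A \<inter> x)) \<longleftrightarrow> even (card (A \<inter> y)))"
proof -
  have "card (A \<inter> x) = card (A \<inter> (x - y)) + card (A \<inter> (x \<inter> y))"
    by (subst card_Un_disjoint[symmetric]) (use assms in \<open>auto intro: arg_cong[where f = card]\<close>)
  moreover have "card (A \<inter> y) = card (A \<inter> (y - x)) + card (A \<inter> (x \<inter> y))"
    by (subst card_Un_disjoint[symmetric]) (use assms in \<open>auto intro: arg_cong[where f = card]\<close>)
  moreover have "card (A \<inter> (x \<triangle> y)) = card (A \<inter> (x - y)) + card (A \<inter> (y - x))"
    by (subst card_Un_disjoint[symmetric]) (use assms in \<open>auto intro: arg_cong[where f = card]\<close>)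
  ultimately show ?thesis by presburger
qed

lemma even_card_sdiff_inter:
  assumes "finite A"
  shows "even (card ((x \<triangle> y) \<inter> A)) \<longleftrightarrow> (even (card (x \<inter> A)) \<longleftrightarrow> even (card (y \<inter> A)))"
  using even_card_inter_sdiff[OF assms] by (simp add: Int_commute)

text \<open>
  A code is a subspace of the vector space of subsets of \<open>I\<close> over the field with two elements.
  A word is identified with its support, so its weight is its cardinality.
\<close>

definition binary_code :: "'a set \<Rightarrow> 'a set set \<Rightarrow> bool" where
  "binary_code I E \<longleftrightarrow> E \<subseteq> Pow I \<and> {} \<in> E \<and> (\<forall>x\<in>E. \<forall>y\<in>E. x \<triangle> y \<in> E)"

definition orth :: "'a set \<Rightarrow> 'a set set \<Rightarrow> bool" where
  "orth A E \<longleftrightarrow> (\<forall>x\<in>E. even (card (A \<inter> x)))"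

lemma binary_codeD:
  assumes "binary_code I E"
  shows "\<And>x. x \<in> E \<Longrightarrow> x \<subseteq> I" "{} \<in> E" "\<And>x y. x \<in> E \<Longrightarrow> y \<in> E \<Longrightarrow> x \<triangle> y \<in> E"
  using assms unfolding binary_code_def by blast+

lemma finite_binary_code: "binary_code I E \<Longrightarrow> finite I \<Longrightarrow> finite E"
  unfolding binary_code_def by (meson finite_Pow_iff finite_subset)

lemma binary_code_Collect:
  assumes "binary_code I E" and "P {}"
    and "\<And>x y. x \<in> E \<Longrightarrow> y \<in> E \<Longrightarrow> P x \<Longrightarrow> P y \<Longrightarrow> P (x \<triangle> y)"
  shows "binary_code I {x \<in> E. P x}"
  using assms unfolding binary_code_def by blast

lemma binary_code_puncture:
  assumes "binary_code I E"
  shows "binary_code (I \<inter> J) ((\<lambda>x. x \<inter> J) ` E)"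
proof -
  have "(x \<inter> J) \<triangle> (y \<inter> J) = (x \<triangle> y) \<inter> J" for x y :: "'a set" by auto
  then show ?thesis using assms unfolding binary_code_def by auto
qed

lemma binary_code_dual:
  assumes "finite I" "E \<subseteq> Pow I"
  shows "binary_code I {A. A \<subseteq> I \<and> orth A E}"
  using assms unfolding binary_code_def orth_def
  by (auto simp: even_card_sdiff_inter finite_subset)

text \<open>
  Adding a word \<open>z\<close> that meets \<open>A\<close> in an odd number of positions permutes the code and flips
  the sign of every term.
\<close>

lemma character_sum:
  assumes E: "binary_code I E" and I: "finite I"
  shows "(\<Sum>x\<in>E. (-1) ^ card (A \<inter> x) :: int) = (if orth A E then int (card E) else 0)"
proof (cases "orth A E")
  case True
  then have "(\<Sum>x\<in>E. (-1) ^ card (A \<inter> x) :: int) = (\<Sum>x\<in>E. 1)"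
    by (intro sum.cong) (auto simp: orth_def)
  then show ?thesis using True by simp
next
  case False
  then obtain z where z: "z \<in> E" "odd (card (A \<inter> z))" by (auto simp: orth_def)
  have bij: "bij_betw (\<lambda>x. x \<triangle> z) E E"
    by (rule bij_betw_byWitness[where f' = "\<lambda>x. x \<triangle> z"])
      (use binary_codeD(3)[OF E _ z(1)] sdiff_cancel in blast)+
  let ?S = "\<Sum>x\<in>E. (-1) ^ card (A \<inter> x) :: int"
  have flip: "(-1) ^ card (A \<inter> (x \<triangle> z)) = - ((-1) ^ card (A \<inter> x) :: int)" if "x \<in> E" for x
  proof -
    have "A \<inter> y = (A \<inter> I) \<inter> y" if "y \<in> E" for y using binary_codeD(1)[OF E that] by auto
    then have "even (card (A \<inter> (x \<triangle> z))) \<longleftrightarrow> \<not> even (card (A \<inter> x))"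
      using z that I even_card_inter_sdiff[of "A \<inter> I" x z] binary_codeD(3)[OF E that z(1)]
      by (metis finite_Int)
    then show ?thesis by (cases "even (card (A \<inter> x))") auto
  qed
  have "?S = (\<Sum>x\<in>E. (-1) ^ card (A \<inter> (x \<triangle> z)))"
    by (rule sum.reindex_bij_betw[OF bij, symmetric])
  also have "\<dots> = - ?S" by (simp add: flip sum_negf)
  finally show ?thesis using False by simp
qed

text \<open>
  Both sides count the same double sum of signs over pairs of a word of \<open>E\<close> and a subset of
  \<open>I\<close>: summed over the words it detects the dual, summed over the subsets it detects the empty
  word.
\<close>

lemma card_dual:
  assumes E: "binary_code I E" and I: "finite I"
  shows "card E * card {A. A \<subseteq> I \<and> orth A E} = 2 ^ card I"
proof -
  have P: "binary_code I (Pow I)" unfolding binary_code_def by auto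
  have fE: "finite E" by (rule finite_binary_code[OF E I])
  have "int (card E * card {A. A \<subseteq> I \<and> orth A E}) = (\<Sum>A\<in>Pow I. if orth A E then int (card E) else 0)"
    using I by (simp add: sum.If_cases Int_def)
  also have "\<dots> = (\<Sum>A\<in>Pow I. \<Sum>x\<in>E. (-1) ^ card (A \<inter> x))"
    by (simp add: character_sum[OF E I])
  also have "\<dots> = (\<Sum>x\<in>E. \<Sum>A\<in>Pow I. (-1) ^ card (x \<inter> A))"
    by (subst sum.swap) (simp add: Int_commute)
  also have "\<dots> = (\<Sum>x\<in>E. if x = {} then 2 ^ card I else 0)"
  proof (rule sum.cong[OF refl])
    fix x assume x: "x \<in> E"
    have "orth x (Pow I) \<longleftrightarrow> x = {}"
    proof
      assume o: "orth x (Pow I)"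
      show "x = {}"
      proof (rule ccontr)
        assume "x \<noteq> {}"
        then obtain i where i: "i \<in> x" by blast
        then have "i \<in> I" using binary_codeD(1)[OF E x] by blast
        then have "even (card (x \<inter> {i}))" using o unfolding orth_def by blast
        then show False using i by simp
      qed
    qed (simp add: orth_def)
    then show "(\<Sum>A\<in>Pow I. (-1) ^ card (x \<inter> A) :: int) = (if x = {} then 2 ^ card I else 0)"
      by (simp add: character_sum[OF P I] card_Pow I)
  qed
  also have "\<dots> = 2 ^ card I" using binary_codeD(2)[OF E] fE by simp
  finally have "int (card E * card {A. A \<subseteq> I \<and> orth A E}) = int (2 ^ card I)" by simp
  then show ?thesis by (simp only: of_nat_eq_iff)
qed

section \<open>Perfect matchings of the positions\<close>

text \<open>
  A perfect matching of \<open>I\<close> is given by the involution that exchanges the partners. A set is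
  \<^emph>\<open>matched\<close> if it is a union of pairs, and \<open>reps\<close> selects the smaller element of each
  pair.
\<close>

definition matching :: "'a set \<Rightarrow> ('a \<Rightarrow> 'a) \<Rightarrow> bool" where
  "matching I f \<longleftrightarrow> (\<forall>i\<in>I. f i \<in> I \<and> f i \<noteq> i \<and> f (f i) = i)"

definition matched :: "('a \<Rightarrow> 'a) \<Rightarrow> 'a set \<Rightarrow> bool" where
  "matched f x \<longleftrightarrow> (\<forall>i\<in>x. f i \<in> x)"

definition reps :: "nat set \<Rightarrow> (nat \<Rightarrow> nat) \<Rightarrow> nat set" where
  "reps I f = {i \<in> I. i < f i}"

lemma matchingD:
  assumes "matching I f" "i \<in> I"
  shows "f i \<in> I" "f i \<noteq> i" "f (f i) = i"
  using assms unfolding matching_def by blast+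

lemma matched_iff:
  assumes "matching I f" "matched f x" "x \<subseteq> I" "i \<in> I"
  shows "f i \<in> x \<longleftrightarrow> i \<in> x"
  using assms unfolding matching_def matched_def by metis

lemma matching_subset:
  "matching I f \<Longrightarrow> matched f J \<Longrightarrow> J \<subseteq> I \<Longrightarrow> matching J f"
  unfolding matching_def matched_def by blast

lemma card_by_pairs:
  assumes f: "matching I f" and I: "finite I" and A: "A \<subseteq> I"
  shows "card A = (\<Sum>r\<in>reps I f. of_bool (r \<in> A) + of_bool (f r \<in> A))"
proof -
  have fin: "finite (reps I f)" using I by (simp add: reps_def)
  have split: "A = {r \<in> reps I f. r \<in> A} \<union> f ` {r \<in> reps I f. f r \<in> A}" (is "A = ?L \<union> ?R")
  proof (rule Set.set_eqI, rule iffI)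
    fix i assume i: "i \<in> A"
    note m = matchingD[OF f subsetD[OF A i]]
    show "i \<in> ?L \<union> ?R"
    proof (cases "i < f i")
      case True then show ?thesis using i A by (auto simp: reps_def)
    next
      case False
      then have "f i < f (f i)" using m by simp
      then have "f i \<in> {r \<in> reps I f. f r \<in> A}" using m i by (simp add: reps_def)
      then have "i \<in> ?R" by (rule image_eqI[rotated]) (simp add: m(3))
      then show ?thesis ..
    qed
  qed auto
  have disj: "?L \<inter> ?R = {}"
  proof -
    have "f r \<notin> reps I f" if "r \<in> reps I f" for r
      using that matchingD(3)[OF f] by (auto simp: reps_def)
    then show ?thesis by blast
  qed
  have inj: "inj_on f (reps I f)"
    by (rule inj_on_inverseI[where g = f]) (use matchingD(3)[OF f] in \<open>simp add: reps_def\<close>)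
  have "card A = card ?L + card ?R"
    by (subst split, rule card_Un_disjoint) (use fin disj in auto)
  also have "card ?R = card {r \<in> reps I f. f r \<in> A}"
    by (rule card_image) (rule inj_on_subset[OF inj], auto)
  finally show ?thesis using fin by (simp add: sum.distrib Int_def)
qed

lemma card_matched:
  assumes f: "matching I f" and I: "finite I" and A: "A \<subseteq> I" "matched f A"
  shows "card A = 2 * card (reps I f \<inter> A)"
proof -
  have fin: "finite (reps I f)" using I by (simp add: reps_def)
  have "card A = (\<Sum>r\<in>reps I f. 2 * of_bool (r \<in> A))"
    unfolding card_by_pairs[OF f I A(1)]
    by (rule sum.cong) (auto simp: matched_iff[OF f A(2,1)] reps_def)
  then show ?thesis using fin by (simp add: sum_distrib_left[symmetric])
qed

lemma exists_matching:
  assumes "finite I" "even (card I)"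
  shows "\<exists>f. matching I f"
  using assms
proof (induction "card I" arbitrary: I rule: less_induct)
  case less
  show ?case
  proof (cases "I = {}")
    case True then have "matching I id" by (simp add: matching_def)
    then show ?thesis by blast
  next
    case False
    then obtain a where a: "a \<in> I" by blast
    have "I \<noteq> {a}" using less.prems by auto
    then obtain b where b: "b \<in> I" "b \<noteq> a" using a by blast
    let ?J = "I - {a, b}"
    have "card ?J = card I - 2" using a b less.prems by (subst card_Diff_subset) auto
    moreover have "card I > 0" using a less.prems by (auto simp: card_gt_0_iff)
    ultimately obtain f where f: "matching ?J f"
      using less.hyps[of ?J] less.prems by auto
    have "matching I (f(a := b, b := a))"
      unfolding matching_def using f a b by (auto simp: matching_def)
    then show ?thesis by blast
  qed
qed

text \<open>
  The shifts of \<open>t\<close> by matched sets are the sets that split the same pairs as \<open>t\<close>. A character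
  sum counts those among them that are dual words: the matched sets form a self-dual code, so
  only the matched words of \<open>E\<close> contribute, each positively by the parity hypothesis, and the
  empty word makes the total positive.
\<close>

lemma exists_matched_shift:
  fixes I :: "nat set"
  assumes E: "binary_code I E" and I: "finite I" and f: "matching I f" and t: "t \<subseteq> I"
    and even: "\<And>x. x \<in> E \<Longrightarrow> matched f x \<Longrightarrow> even (card (t \<inter> x))"
  shows "\<exists>B\<subseteq>I. matched f B \<and> orth (t \<triangle> B) E"
proof -
  define P where "P = {B \<in> Pow I. matched f B}"
  have fi: "f i \<in> B \<longleftrightarrow> i \<in> B" if "B \<in> P" "i \<in> I" for B i
    using that matched_iff[OF f] by (simp add: P_def)
  have P: "binary_code I P" unfolding P_def
  proof (rule binary_code_Collect)
    fix x y assume "x \<in> Pow I" "y \<in> Pow I" "matched f x" "matched f y"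
    then show "matched f (x \<triangle> y)"
      using matched_iff[OF f, of x] matched_iff[OF f, of y] unfolding matched_def by blast
  qed (auto simp: binary_code_def matched_def)
  have oP: "orth x P \<longleftrightarrow> matched f x" if "x \<subseteq> I" for x
  proof
    assume o: "orth x P"
    show "matched f x" unfolding matched_def
    proof (rule ballI, rule ccontr)
      fix i assume i: "i \<in> x" "f i \<notin> x"
      then have "{i, f i} \<in> P" using that matchingD[OF f] by (auto simp: P_def matched_def)
      then have "even (card (x \<inter> {i, f i}))" using o by (auto simp: orth_def)
      moreover have "x \<inter> {i, f i} = {i}" using i by auto
      ultimately show False by simp
    qed
  next
    assume m: "matched f x"
    show "orth x P" unfolding orth_def
    proof
      fix B assume "B \<in> P"
      then have "matched f (x \<inter> B)" using m by (auto simp: P_def matched_def)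
      then show "even (card (x \<inter> B))" using card_matched[OF f I le_infI1[OF that]] by simp
    qed
  qed
  have fE: "finite E" and fP: "finite P" by (rule finite_binary_code[OF _ I], fact)+
  have "(\<Sum>B\<in>P. if orth (t \<triangle> B) E then int (card E) else 0)
      = (\<Sum>B\<in>P. \<Sum>x\<in>E. (-1) ^ card ((t \<triangle> B) \<inter> x))"
    by (simp add: character_sum[OF E I])
  also have "\<dots> = (\<Sum>x\<in>E. \<Sum>B\<in>P. (-1) ^ card (t \<inter> x) * (-1) ^ card (x \<inter> B))"
  proof (subst sum.swap, intro sum.cong refl)
    fix x B assume "x \<in> E" "B \<in> P"
    then have "finite x" using binary_codeD(1)[OF E] I by (meson finite_subset)
    from even_card_sdiff_inter[OF this, of t B]
    show "(-1) ^ card ((t \<triangle> B) \<inter> x) = (-1) ^ card (t \<inter> x) * ((-1) ^ card (x \<inter> B) :: int)"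
      by (cases "even (card (t \<inter> x))"; cases "even (card (x \<inter> B))") (simp_all add: Int_commute)
  qed
  also have "\<dots> = (\<Sum>x\<in>E. if matched f x then int (card P) else 0)"
  proof (rule sum.cong[OF refl])
    fix x assume x: "x \<in> E"
    have "(\<Sum>B\<in>P. (-1) ^ card (t \<inter> x) * (-1) ^ card (x \<inter> B))
      = (-1) ^ card (t \<inter> x) * (if matched f x then int (card P) else 0)"
      by (simp only: sum_distrib_left[symmetric] character_sum[OF P I] oP[OF binary_codeD(1)[OF E x]])
    also have "\<dots> = (if matched f x then int (card P) else 0)" using even[OF x] by simp
    finally show "(\<Sum>B\<in>P. (-1) ^ card (t \<inter> x) * (-1) ^ card (x \<inter> B))
      = (if matched f x then int (card P) else 0)" .
  qed
  also have "\<dots> > 0"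
  proof -
    have "{} \<in> E" "matched f {}" by (auto simp: binary_codeD[OF E] matched_def)
    moreover have "card P > 0" using binary_codeD(2)[OF P] fP by (auto simp: card_gt_0_iff)
    ultimately show ?thesis using fE by (intro sum_pos2[of _ "{}"]) auto
  qed
  finally have pos: "(\<Sum>B\<in>P. if orth (t \<triangle> B) E then int (card E) else 0) > 0" .
  have "\<exists>B\<in>P. orth (t \<triangle> B) E"
  proof (rule ccontr)
    assume "\<not> ?thesis"
    then show False using pos by simp
  qed
  then obtain B where "B \<in> P" "orth (t \<triangle> B) E" by blast
  then show ?thesis by (auto simp: P_def)
qed

text \<open>
  A set that contains exactly one element of each pair has half the weight of \<open>I\<close>; the shifts
  of \<open>reps I f\<close> by matched sets are all such sets.
\<close>

lemma exists_half_weight: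
  fixes I :: "nat set"
  assumes E: "binary_code I E" and I: "finite I" and f: "matching I f"
    and dvd: "\<And>x. x \<in> E \<Longrightarrow> matched f x \<Longrightarrow> 4 dvd card x"
  shows "\<exists>A\<subseteq>I. orth A E \<and> 2 * card A = card I"
proof -
  let ?T = "reps I f"
  have T: "?T \<subseteq> I" by (auto simp: reps_def)
  have "even (card (?T \<inter> x))" if "x \<in> E" "matched f x" for x
    using card_matched[OF f I binary_codeD(1)[OF E that(1)] that(2)] dvd[OF that] by auto
  from exists_matched_shift[OF E I f T this]
  obtain B where B: "B \<subseteq> I" "matched f B" "orth (?T \<triangle> B) E" by blast
  have fin: "finite ?T" using I by (simp add: reps_def)
  have "card (?T \<triangle> B) = (\<Sum>r\<in>?T. of_bool (r \<in> ?T \<triangle> B) + of_bool (f r \<in> ?T \<triangle> B))"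
    by (rule card_by_pairs[OF f I]) (use T B in auto)
  also have "\<dots> = (\<Sum>r\<in>?T. 1)"
  proof (rule sum.cong[OF refl])
    fix r assume r: "r \<in> ?T"
    then have "r \<in> I" "f r \<notin> ?T" using matchingD[OF f] by (auto simp: reps_def)
    then show "of_bool (r \<in> ?T \<triangle> B) + of_bool (f r \<in> ?T \<triangle> B) = (1::nat)"
      using r matched_iff[OF f B(2,1), of r] by auto
  qed
  also have "\<dots> = card (?T \<inter> I)" using T by (simp add: Int_absorb2)
  also have "2 * \<dots> = card I"
    by (rule card_matched[OF f I, symmetric]) (use matchingD[OF f] in \<open>auto simp: matched_def\<close>)
  finally have "2 * card (?T \<triangle> B) = card I" by simp
  then show ?thesis using B T by (intro exI[of _ "?T \<triangle> B"]) auto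
qed

section \<open>Digraphs with a forbidden number of vertices of odd out-degree\<close>

definition outdeg :: "('a \<Rightarrow> 'a \<Rightarrow> bool) \<Rightarrow> 'a set \<Rightarrow> 'a \<Rightarrow> nat" where
  "outdeg Y U r = card {s \<in> U - {r}. Y r s}"

definition odd_vertices :: "('a \<Rightarrow> 'a \<Rightarrow> bool) \<Rightarrow> 'a set \<Rightarrow> nat" where
  "odd_vertices Y U = card {r \<in> U. odd (outdeg Y U r)}"

lemma card_filter: "finite A \<Longrightarrow> card {s \<in> A. P s} = (\<Sum>s\<in>A. of_bool (P s))"
  by (simp add: Int_def)

lemma outdeg_insert:
  assumes "finite F" "r \<notin> F"
  shows "outdeg Y (insert r F) r = (\<Sum>s\<in>F. of_bool (Y r s))"
  using assms by (simp add: outdeg_def card_filter)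

lemma odd_vertices_sum:
  "finite U \<Longrightarrow> odd_vertices Y U = (\<Sum>r\<in>U. of_bool (odd (outdeg Y U r)))"
  by (simp add: odd_vertices_def card_filter)

text \<open>
  The digraphs that arise from codes satisfy \<open>avoid\<close> because no dual word has weight \<open>2 * k\<close>.
  What is needed is that an odd set of vertices then induces as many arcs, modulo two, as it
  would in a tournament.
\<close>

locale avoiding_digraph =
  fixes V :: "'a set" and Y :: "'a \<Rightarrow> 'a \<Rightarrow> bool"
  assumes finite_V: "finite V" and odd_V: "odd (card V)"
    and odd_rows: "r \<in> V \<Longrightarrow> odd (outdeg Y V r)"
    and avoid: "U \<subseteq> V \<Longrightarrow> odd (card U) \<Longrightarrow> 2 * odd_vertices Y U \<noteq> card U + 1"
begin

definition sep :: "'a \<Rightarrow> 'a \<Rightarrow> 'a \<Rightarrow> bool" where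
  "sep x s t \<longleftrightarrow> Y x s \<noteq> Y x t"

text \<open>
  A triple is \<^emph>\<open>unseparated\<close> if each of its vertices has arcs to both of the others or
  to neither of them. By \<open>three_vertices\<close>, these are the triples that span an even number of
  arcs.
\<close>

definition unsep :: "'a \<Rightarrow> 'a \<Rightarrow> 'a \<Rightarrow> bool" where
  "unsep r s t \<longleftrightarrow> \<not> sep r s t \<and> \<not> sep s r t \<and> \<not> sep t r s"

lemma sep_commute: "sep x s t \<longleftrightarrow> sep x t s"
  by (auto simp: sep_def)

lemma outdeg_three_vertices:
  assumes "distinct [a, b, c]" "U = {a, b, c}"
  shows "odd (outdeg Y U a) \<longleftrightarrow> sep a b c"
proof -
  have "outdeg Y U a = of_bool (Y a b) + of_bool (Y a c)"
    using outdeg_insert[of "{b, c}" a Y] assms by simp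
  then show ?thesis by (simp add: sep_def)
qed

text \<open>
  Otherwise exactly two, a forbidden number, of the three vertices have odd out-degree in the
  triple.
\<close>

lemma three_vertices:
  assumes "distinct [r, s, t]" "{r, s, t} \<subseteq> V" "sep r s t" "sep s r t"
  shows "sep t r s"
proof (rule ccontr)
  assume n: "\<not> sep t r s"
  let ?U = "{r, s, t}"
  have "odd (outdeg Y ?U r)" "odd (outdeg Y ?U s)" "even (outdeg Y ?U t)"
    using outdeg_three_vertices[of r s t ?U] outdeg_three_vertices[of s r t ?U] outdeg_three_vertices[of t r s ?U] assms n
    by (auto simp: insert_commute)
  then have "odd_vertices Y ?U = 2"
    using assms by (simp add: odd_vertices_sum)
  moreover have "card ?U = 3" using assms by simp
  ultimately show False using avoid[OF assms(2)] by simp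
qed

lemma outdeg_five_vertices:
  assumes "distinct [a, b, c, d, e]" "U = {a, b, c, d, e}"
  shows "odd (outdeg Y U a) \<longleftrightarrow> sep a b c \<noteq> sep a d e"
proof -
  have "outdeg Y U a = of_bool (Y a b) + of_bool (Y a c) + of_bool (Y a d) + of_bool (Y a e)"
    using outdeg_insert[of "{b, c, d, e}" a Y] assms by simp
  then show ?thesis by (simp add: sep_def)
qed

text \<open>
  Under these hypotheses exactly \<open>x\<close>, \<open>s\<close> and \<open>v\<close> have odd out-degree among the five vertices,
  which is the forbidden number.
\<close>

lemma five_vertices:
  assumes d: "distinct [x, s, v, t, u]" and V: "{x, s, v, t, u} \<subseteq> V"
    and x: "sep x s v" "\<not> sep x t u"
    and s: "sep s v x" "\<not> sep s t u"
    and v: "sep v x s" "\<not> sep v t u"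
    and t: "\<not> sep t x u" "\<not> sep t s v"
    and u: "\<not> sep u x t" "\<not> sep u s v"
  shows False
proof -
  let ?U = "{x, s, v, t, u}"
  have "odd (outdeg Y ?U x)" "odd (outdeg Y ?U s)" "odd (outdeg Y ?U v)"
    using outdeg_five_vertices[of x s v t u ?U] outdeg_five_vertices[of s v x t u ?U]
      outdeg_five_vertices[of v x s t u ?U] d x s v
    by (auto simp: insert_commute)
  moreover have "even (outdeg Y ?U t)" "even (outdeg Y ?U u)"
    using outdeg_five_vertices[of t x u s v ?U] outdeg_five_vertices[of u x t s v ?U] d t u
    by (auto simp: insert_commute)
  ultimately have "odd_vertices Y ?U = 3"
    using d by (simp add: odd_vertices_sum)
  moreover have "card ?U = 5" using d by simp
  ultimately show False using avoid[OF V] by simp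
qed

lemma unsep_iff:
  assumes "distinct [r, s, t]" "{r, s, t} \<subseteq> V"
  shows "unsep r s t \<longleftrightarrow> (sep r s t \<longleftrightarrow> (sep s r t \<noteq> sep t r s))"
  using three_vertices[of r s t] three_vertices[of r t s] three_vertices[of s t r] assms
  unfolding unsep_def sep_commute[of r t s] sep_commute[of t s r] sep_commute[of s t r]
  by auto

text \<open>
  Any vertex of a four-element set lies in three of its triples, and its separations of the
  three pairs of other vertices add up to an even number. Hence the number of triples with an
  odd number of arcs is even.
\<close>

lemma unsep_four_vertices:
  assumes "distinct [x, s, t, u]" "{x, s, t, u} \<subseteq> V"
    and "unsep x t u" "\<not> unsep x s t" "\<not> unsep x s u"
  shows "unsep s t u"
  using assms(3-) assms(1,2) unsep_iff[of x t u] unsep_iff[of x s t] unsep_iff[of x s u] unsep_iff[of s t u]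
  by (simp add: sep_def) argo

text \<open>
  Infinite descent on the number of vertices that \<open>x\<close> separates from \<open>t\<close>. This number is odd,
  as the out-degree of \<open>x\<close> is odd and the number of the other vertices even; so there is such
  a vertex \<open>s\<close>. Then \<open>s\<close>, \<open>t\<close>, \<open>u\<close> are unseparated as well, and \<open>s\<close> separates strictly fewer
  vertices from \<open>t\<close>: a vertex \<open>v\<close> that violates this would complete a forbidden set of five
  vertices.
\<close>

lemma not_unsep:
  assumes "distinct [x, t, u]" "{x, t, u} \<subseteq> V"
  shows "\<not> unsep x t u"
  using assms
proof (induction "card {v \<in> V - {x}. sep x v t}" arbitrary: x t u rule: less_induct)
  case less
  let ?P = "\<lambda>x t. {v \<in> V - {x}. sep x v t}"
  have finP: "finite (?P x t)" for x t using finite_V by simp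
  show ?case
  proof
    assume xtu: "unsep x t u"
    then have none: "\<not> sep x t u" "\<not> sep t x u" "\<not> sep u x t" by (auto simp: unsep_def)
    have "even (card (V - {x}))" using odd_V finite_V less.prems by (simp add: card_Diff_singleton)
    moreover have "card (V - {x}) = outdeg Y V x + card {v \<in> V - {x}. \<not> Y x v}"
      unfolding outdeg_def using finite_V
      by (subst card_Un_disjoint[symmetric]) (auto intro: arg_cong[where f = card])
    ultimately have "odd (card {v \<in> V - {x}. \<not> Y x v})" "odd (card {v \<in> V - {x}. Y x v})"
      using odd_rows[of x] less.prems by (auto simp: outdeg_def)
    then have "odd (card (?P x t))" by (cases "Y x t") (simp_all add: sep_def)
    then have "?P x t \<noteq> {}" by (metis card.empty even_zero)
    then obtain s where s: "s \<in> V" "s \<noteq> x" "sep x s t" by blast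
    then have d: "distinct [x, s, t, u]" using less.prems none by (auto simp: sep_def)
    have V: "{x, s, t, u} \<subseteq> V" using less.prems s by auto
    have xsu: "sep x s u" using s none by (auto simp: sep_def)
    \<comment> \<open>Two of the four triples have an odd number of arcs, so the fourth has an even number.\<close>
    have stu: "unsep s t u"
      by (rule unsep_four_vertices[OF d V xtu]) (use s xsu in \<open>auto simp: unsep_def\<close>)
    have ts: "\<not> sep t x s" using none stu by (auto simp: sep_def unsep_def)
    have sx: "\<not> sep s x t" using three_vertices[of x s t] d V s ts by (auto simp: sep_def)
    have "?P s t \<subseteq> ?P x t - {s}"
    proof
      fix v assume "v \<in> ?P s t"
      then have v: "v \<in> V" "v \<noteq> s" "sep s v t" by auto
      show "v \<in> ?P x t - {s}"
      proof (rule ccontr)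
        assume "v \<notin> ?P x t - {s}"
        moreover have vx: "v \<noteq> x" using v sx by (auto simp: sep_def)
        ultimately have xv: "\<not> sep x v t" using v by blast
        have dv: "distinct [x, s, v, t, u]" and Vv: "{x, s, v, t, u} \<subseteq> V"
          using d V v vx stu by (auto simp: sep_def unsep_def)
        have svu: "sep s v u" using v stu by (auto simp: sep_def unsep_def)
        have vtu: "unsep v t u"
          by (rule unsep_four_vertices[of s v t u]) (use dv Vv stu v svu in \<open>auto simp: unsep_def\<close>)
        have vs: "sep v x s" using three_vertices[of x s v] dv Vv s xv v sx by (auto simp: sep_def)
        show False
          by (rule five_vertices[OF dv Vv])
            (use s xv none v sx stu vs vtu in \<open>auto simp: sep_def unsep_def\<close>)
      qed
    qed
    moreover have "s \<in> ?P x t" using s by simp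
    ultimately have "card (?P s t) < card (?P x t)"
      by (intro psubset_card_mono finP) blast
    then show False using less.hyps[of s t u] d V stu by auto
  qed
qed

definition arcs :: "'a set \<Rightarrow> nat" where
  "arcs U = (\<Sum>r\<in>U. outdeg Y U r)"

lemma odd_arcs: "finite U \<Longrightarrow> odd (arcs U) \<longleftrightarrow> odd (odd_vertices Y U)"
  unfolding arcs_def odd_vertices_def by (rule even_sum_iff[THEN arg_cong[where f = Not]])

lemma outdeg_insert_other:
  "finite U \<Longrightarrow> r \<in> U \<Longrightarrow> x \<notin> U \<Longrightarrow> outdeg Y (insert x U) r = outdeg Y U r + of_bool (Y r x)"
  unfolding outdeg_def by (subst (1 2) card_filter) (auto simp: insert_Diff_if)

lemma arcs_insert:
  assumes "finite U" "x \<notin> U"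
  shows "arcs (insert x U) = arcs U + (\<Sum>s\<in>U. of_bool (Y x s) + of_bool (Y s x))"
  using assms by (simp add: arcs_def outdeg_insert outdeg_insert_other sum.distrib)

text \<open>
  Each \<open>s\<close> in \<open>U\<close> forms with \<open>x\<close> and \<open>y\<close> a triple with an odd number of arcs. Summed over the
  odd number of all \<open>s\<close>, the arcs between \<open>x\<close> and \<open>y\<close> are counted an odd number of times, so
  the sum has the parity of the number of new arcs.
\<close>

lemma arcs_add_pair:
  assumes U: "U \<subseteq> V" "odd (card U)" and xy: "x \<in> V - U" "y \<in> V - U" "x \<noteq> y"
  shows "odd (arcs (insert x (insert y U))) \<longleftrightarrow> even (arcs U)"
proof -
  have fin: "finite U" using finite_V U finite_subset by blast
  define a :: "'a \<Rightarrow> 'a \<Rightarrow> nat" where "a p q = of_bool (Y p q) + of_bool (Y q p)" for p q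
  have oddt: "odd (a x s + a y s + a x y)" if "s \<in> U" for s
  proof -
    have d: "distinct [s, x, y]" "{s, x, y} \<subseteq> V" using that U xy by auto
    from not_unsep[OF d] unsep_iff[OF d] show ?thesis by (auto simp: sep_def a_def)
  qed
  have "{s \<in> U. odd (a x s + a y s + a x y)} = U" using oddt by blast
  then have "odd (\<Sum>s\<in>U. a x s + a y s + a x y)"
    using U(2) by (simp only: even_sum_iff[OF fin]) simp
  moreover have "(\<Sum>s\<in>U. a x s + a y s + a x y) = (\<Sum>s\<in>U. a x s) + (\<Sum>s\<in>U. a y s) + card U * a x y"
    by (simp add: sum.distrib)
  moreover have "arcs (insert x (insert y U)) = arcs U + (\<Sum>s\<in>U. a y s) + (\<Sum>s\<in>U. a x s) + a x y"
    using fin xy by (simp add: arcs_insert a_def)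
  moreover have "odd (card U * a x y) \<longleftrightarrow> odd (a x y)" using U(2) by simp
  ultimately show ?thesis by (simp only: even_add) argo
qed

lemma odd_vertices_parity:
  assumes "U \<subseteq> V" "odd (card U)"
  shows "odd (odd_vertices Y U) \<longleftrightarrow> odd ((card U - 1) div 2)"
proof -
  have "odd (arcs U) \<longleftrightarrow> odd h" if "U \<subseteq> V" "card U = 2 * h + 1" for h U
    using that
  proof (induction h arbitrary: U)
    case 0
    then obtain x where "U = {x}" by (auto simp: card_1_singleton_iff)
    then show ?case by (simp add: arcs_def outdeg_def)
  next
    case (Suc h)
    have fin: "finite U" using finite_V Suc.prems finite_subset by blast
    from Suc.prems obtain x where x: "x \<in> U" by fastforce
    have "card (U - {x}) = 2 * h + 2" using x fin Suc.prems by simp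
    then have "U - {x} \<noteq> {}" by (metis add_eq_0_iff_both_eq_0 card.empty zero_neq_numeral)
    then obtain y where y: "y \<in> U - {x}" by blast
    let ?U = "U - {x} - {y}"
    have c: "card ?U = 2 * h + 1" using x y fin Suc.prems by (subst card_Diff_singleton) auto
    have "U = insert x (insert y ?U)" using x y by auto
    then have "odd (arcs U) \<longleftrightarrow> even (arcs ?U)"
      using arcs_add_pair[of ?U x y] c x y Suc.prems by auto
    then show ?case using Suc.IH[of ?U] c Suc.prems by auto
  qed
  moreover from assms(2) have "card U = 2 * ((card U - 1) div 2) + 1" by presburger
  ultimately show ?thesis
    using odd_arcs finite_subset[OF assms(1) finite_V] assms(1) by blast
qed
end

section \<open>The exchange argument\<close>

lemma card_hom_image_le:
  assumes W: "binary_code I W" and I: "finite I" and K: "K \<subseteq> W"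
    and hom: "\<And>x y. x \<in> W \<Longrightarrow> y \<in> W \<Longrightarrow> h (x \<triangle> y) = h x \<triangle> h y"
    and ker: "\<And>x. x \<in> K \<Longrightarrow> h x = {}" and Z: "Z \<subseteq> h ` W"
  shows "card K * card Z \<le> card W"
proof -
  have "\<forall>z\<in>Z. \<exists>w\<in>W. h w = z" using Z by blast
  then obtain g where g: "\<And>z. z \<in> Z \<Longrightarrow> g z \<in> W \<and> h (g z) = z" by metis
  let ?m = "\<lambda>(x, z). x \<triangle> g z"
  have "inj_on ?m (K \<times> Z)"
  proof (rule inj_onI, clarify)
    fix x z x' z' assume *: "x \<in> K" "z \<in> Z" "x' \<in> K" "z' \<in> Z" "x \<triangle> g z = x' \<triangle> g z'"
    have val: "h (x \<triangle> g z) = z" if "x \<in> K" "z \<in> Z" for x z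
      using hom[of x "g z"] ker[OF that(1)] g[OF that(2)] K that(1) by auto
    have zz: "z = z'" using val[OF *(1,2)] val[OF *(3,4)] *(5) by simp
    then have "(x \<triangle> g z) \<triangle> g z = (x' \<triangle> g z) \<triangle> g z" using * by simp
    then show "x = x' \<and> z = z'" using zz unfolding sdiff_cancel by simp
  qed
  moreover have "?m ` (K \<times> Z) \<subseteq> W" using g K binary_codeD(3)[OF W] by auto
  ultimately have "card (K \<times> Z) \<le> card W" by (intro card_inj_on_le finite_binary_code[OF W I])
  then show ?thesis by (simp add: card_cartesian_product)
qed

lemma Pow_subset_if_singletons:
  assumes "finite Z" and "{} \<in> F" and "\<And>x y. x \<in> F \<Longrightarrow> y \<in> F \<Longrightarrow> x \<triangle> y \<in> F"
    and "\<And>z. z \<in> Z \<Longrightarrow> {z} \<in> F"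
  shows "Pow Z \<subseteq> F"
proof
  fix R assume "R \<in> Pow Z"
  then have "finite R" "R \<subseteq> Z" using assms(1) finite_subset by auto
  then show "R \<in> F"
  proof (induction R)
    case (insert r R)
    then have "{r} \<triangle> R \<in> F" by (intro assms(3,4)) auto
    moreover have "{r} \<triangle> R = insert r R" using insert.hyps by auto
    ultimately show ?case by simp
  qed (simp add: assms)
qed

text \<open>
  Let the word \<open>z\<close> contain the pair of \<open>a\<close> and avoid the pair of \<open>c\<close>. Re-pairing \<open>a\<close> with \<open>c\<close>
  and \<open>f a\<close> with \<open>f c\<close> destroys the matched word \<open>z\<close>. As \<open>f\<close> has the fewest matched words, a
  new one appears, and it splits precisely the two old pairs.
\<close>

lemma exchange:
  assumes W: "binary_code I W" and I: "finite I" and f: "matching I f"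
    and min: "\<And>g. matching I g \<Longrightarrow> card {x \<in> W. matched f x} \<le> card {x \<in> W. matched g x}"
    and z: "z \<in> W" "matched f z" and a: "a \<in> z" and c: "c \<in> I - z"
  shows "\<exists>x\<in>W. \<forall>i\<in>I. (i \<in> x) \<noteq> (f i \<in> x) \<longleftrightarrow> i \<in> {a, f a, c, f c}"
proof -
  define b d where "b = f a" and "d = f c"
  have aI: "a \<in> I" and cI: "c \<in> I" using a c binary_codeD(1)[OF W z(1)] by auto
  have bI: "b \<in> I" "b \<noteq> a" "f b = a" and dI: "d \<in> I" "d \<noteq> c" "f d = c"
    using matchingD[OF f aI] matchingD[OF f cI] by (auto simp: b_def d_def)
  have bz: "b \<in> z" using z a by (auto simp: matched_def b_def)
  have dz: "d \<notin> z" using z c dI by (auto simp: matched_def)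
  have dist: "a \<noteq> c" "a \<noteq> d" "b \<noteq> c" "b \<noteq> d" using a bz c dz by auto
  define g where "g = f(a := c, c := a, b := d, d := b)"
  have f_other: "f i \<notin> {a, b, c, d}" if "i \<in> I" "i \<notin> {a, b, c, d}" for i
    using that matchingD(3)[OF f that(1)] b_def d_def bI dI by auto
  have g: "matching I g"
    unfolding matching_def
  proof
    fix i assume i: "i \<in> I"
    show "g i \<in> I \<and> g i \<noteq> i \<and> g (g i) = i"
    proof (cases "i \<in> {a, b, c, d}")
      case True then show ?thesis using dist aI bI cI dI by (auto simp: g_def)
    next
      case False
      then show ?thesis using f_other[OF i] matchingD[OF f i] by (simp add: g_def)
    qed
  qed
  let ?K = "\<lambda>f. {x \<in> W. matched f x}"
  \<comment> \<open>A smaller set of matched words would contradict the choice of \<open>f\<close>.\<close>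
  have "\<not> ?K g \<subseteq> ?K f"
  proof
    assume sub: "?K g \<subseteq> ?K f"
    have "g a = c" using dist bI by (simp add: g_def)
    then have "z \<notin> ?K g" using a c by (auto simp: matched_def)
    then have "?K g \<subset> ?K f" using sub z by blast
    then have "card (?K g) < card (?K f)"
      by (rule psubset_card_mono[rotated]) (use finite_binary_code[OF W I] in simp)
    then show False using min[OF g] by simp
  qed
  then obtain x where x: "x \<in> W" "matched g x" "\<not> matched f x" by blast
  have gx: "g i \<in> x \<longleftrightarrow> i \<in> x" if "i \<in> I" for i
    by (rule matched_iff[OF g x(2) binary_codeD(1)[OF W x(1)] that])
  have ac: "a \<in> x \<longleftrightarrow> c \<in> x" using gx[OF aI] dist bI by (simp add: g_def)
  have bd: "b \<in> x \<longleftrightarrow> d \<in> x" using gx[OF bI(1)] dist by (simp add: g_def)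
  have other: "f i \<in> x \<longleftrightarrow> i \<in> x" if "i \<in> I" "i \<notin> {a, b, c, d}" for i
    using gx[OF that(1)] that(2) by (simp add: g_def)
  have fs: "f a = b" "f b = a" "f c = d" "f d = c" using bI dI by (simp_all add: b_def d_def)
  obtain i where i: "i \<in> x" "f i \<notin> x" using x(3) by (auto simp: matched_def)
  then have "i \<in> {a, b, c, d}" using other binary_codeD(1)[OF W x(1)] by blast
  then have ab: "(a \<in> x) \<noteq> (b \<in> x)" using i fs ac bd by auto
  have "(i \<in> x) \<noteq> (f i \<in> x) \<longleftrightarrow> i \<in> {a, b, c, d}" if "i \<in> I" for i
    using other[OF that] ab ac bd fs by (cases "i \<in> {a, b, c, d}") auto
  then show ?thesis using x(1) unfolding b_def d_def by blast
qed

text \<open>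
  By \<open>exchange\<close>, there are words that split precisely one pair inside \<open>z\<close> and one outside.
  Their sums attain every pattern of split pairs on all pairs but one, and the matched words
  are the kernel of the map to these patterns.
\<close>

lemma card_ge_if_matched:
  assumes W: "binary_code I W" and I: "finite I" and f: "matching I f"
    and min: "\<And>g. matching I g \<Longrightarrow> card {x \<in> W. matched f x} \<le> card {x \<in> W. matched g x}"
    and z: "z \<in> W" "matched f z" "z \<noteq> {}" "z \<noteq> I"
  shows "card {x \<in> W. matched f x} * 2 ^ (card (reps I f) - 1) \<le> card W"
proof -
  let ?T = "reps I f"
  have finT: "finite ?T" using I by (simp add: reps_def)
  have TI: "?T \<subseteq> I" by (auto simp: reps_def)
  have fT: "f r \<notin> ?T" if "r \<in> ?T" for r using that matchingD(3)[OF f] by (auto simp: reps_def)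
  have rep: "\<exists>r\<in>?T. r = i \<or> f r = i" if "i \<in> I" for i
  proof (cases "i < f i")
    case True then show ?thesis using that by (auto simp: reps_def)
  next
    case False
    then have "f i \<in> ?T" using matchingD[OF f that] by (auto simp: reps_def)
    then show ?thesis using matchingD[OF f that] by blast
  qed
  note fz = matched_iff[OF f z(2) binary_codeD(1)[OF W z(1)]]
  obtain a where a: "a \<in> ?T" "a \<in> z" using z binary_codeD(1)[OF W z(1)] rep fz TI by (metis subsetD ex_in_conv)
  obtain c where c: "c \<in> ?T" "c \<notin> z" using z binary_codeD(1)[OF W z(1)] rep fz TI by (metis subsetD subsetI subset_antisym)
  define h where "h x = {r \<in> ?T. (r \<in> x) \<noteq> (f r \<in> x)}" for x
  have pair: "\<exists>x\<in>W. h x = {p, q}" if p: "p \<in> ?T" "p \<in> z" and q: "q \<in> ?T" "q \<notin> z" for p q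
  proof -
    obtain x where x: "x \<in> W" "\<forall>i\<in>I. (i \<in> x) \<noteq> (f i \<in> x) \<longleftrightarrow> i \<in> {p, f p, q, f q}"
      using exchange[OF W I f min z(1,2), of p q] p q TI by blast
    then have "h x = {p, q}" unfolding h_def using fT p q TI by auto
    then show ?thesis using x by blast
  qed
  have hom: "h (x \<triangle> y) = h x \<triangle> h y" for x y unfolding h_def by blast
  \<comment> \<open>Only even patterns need to occur; forgetting \<open>a\<close> makes every pattern on the other pairs occur.\<close>
  let ?h = "\<lambda>x. h x - {a}"
  have ac: "\<exists>x\<in>W. ?h x = {r}" if r: "r \<in> ?T - {a}" for r
  proof (cases "r \<in> z")
    case False
    then obtain x where "x \<in> W" "h x = {a, r}" using pair[of a r] a r by blast
    then show ?thesis using r by (intro bexI[of _ x]) auto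
  next
    case True
    then obtain x where x: "x \<in> W" "h x = {r, c}" using pair[of r c] c r by blast
    obtain y where y: "y \<in> W" "h y = {a, c}" using pair[of a c] a c by blast
    have "h (x \<triangle> y) = {r, c} \<triangle> {a, c}" using hom x y by simp
    also have "\<dots> - {a} = {r}" using r c a True by auto
    finally show ?thesis using binary_codeD(3)[OF W x(1) y(1)] by blast
  qed
  have "Pow (?T - {a}) \<subseteq> ?h ` W"
  proof (rule Pow_subset_if_singletons)
    show "{} \<in> ?h ` W" using binary_codeD(2)[OF W] by (force simp: h_def)
    fix x y assume "x \<in> ?h ` W" "y \<in> ?h ` W"
    then obtain x' y' where *: "x' \<in> W" "y' \<in> W" "x = ?h x'" "y = ?h y'" by blast
    have "?h (x' \<triangle> y') = x \<triangle> y" unfolding hom * by blast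
    then show "x \<triangle> y \<in> ?h ` W" using binary_codeD(3)[OF W *(1,2)] by blast
  next
    fix r assume "r \<in> ?T - {a}"
    then show "{r} \<in> ?h ` W" using ac[of r] by (metis imageI)
  qed (use finT in simp)
  then have "card {x \<in> W. matched f x} * card (Pow (?T - {a})) \<le> card W"
  proof (intro card_hom_image_le[OF W I, where h = ?h])
    show "?h (x \<triangle> y) = ?h x \<triangle> ?h y" for x y unfolding hom by blast
    show "?h x = {}" if "x \<in> {x \<in> W. matched f x}" for x
      using that matched_iff[OF f _ binary_codeD(1)[OF W], of x] TI by (auto simp: h_def)
  qed auto
  then show ?thesis using finT a by (simp add: card_Pow card_Diff_singleton)
qed

section \<open>Codes of length 4k+2 whose duals have no word of weight 2k\<close>

locale midweight_free =
  fixes I :: "nat set" and E :: "nat set set" and k :: nat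
  assumes finite_I: "finite I" and card_I: "card I = 4 * k + 2"
    and code: "binary_code I E" and I_in: "I \<in> E" and card_E: "card E \<le> 2 ^ (2 * k + 2)"
    and free: "A \<subseteq> I \<Longrightarrow> orth A E \<Longrightarrow> card A \<noteq> 2 * k"
begin

lemma E_sub: "x \<in> E \<Longrightarrow> x \<subseteq> I"
  by (rule binary_codeD(1)[OF code])

lemma E_fin: "x \<in> E \<Longrightarrow> finite x"
  using E_sub finite_I finite_subset by blast

lemma E_compl: "x \<in> E \<Longrightarrow> I - x \<in> E"
  using binary_codeD(3)[OF code I_in, of x] E_sub[of x] by (simp add: Diff_eq_empty_iff[THEN iffD2])

lemma card_reps: "matching I f \<Longrightarrow> card (reps I f) = 2 * k + 1"
  using card_matched[OF _ finite_I subset_refl, of f] card_I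
  by (simp add: matched_def matching_def reps_def Int_def conj_commute cong: conj_cong)

text \<open>
  Remove the pair of \<open>a\<close>. A dual word with one element from each of the remaining \<open>2 * k\<close>
  pairs would have weight \<open>2 * k\<close>, so \<open>exists_half_weight\<close> must fail for the remaining
  positions.
\<close>

lemma exists_near_matched_word:
  assumes f: "matching I f" and a: "a \<in> I"
  shows "\<exists>x\<in>E. matched f (x - {a, f a}) \<and> \<not> 4 dvd card (x - {a, f a})"
proof (rule ccontr)
  assume c: "\<not> ?thesis"
  let ?J = "I - {a, f a}"
  let ?E = "(\<lambda>x. x \<inter> ?J) ` E"
  note fa = matchingD[OF f a]
  have E: "binary_code ?J ?E"
    using binary_code_puncture[OF code, of ?J] by (simp add: Int_absorb1 Int_Diff)
  have "matched f ?J"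
    unfolding matched_def using matchingD[OF f] fa by (metis DiffD1 DiffD2 DiffI insert_iff singletonD)
  then have J: "matching ?J f" using matching_subset[OF f] by blast
  have xJ: "x \<inter> ?J = x - {a, f a}" if "x \<in> E" for x using E_sub[OF that] by blast
  have "\<exists>A\<subseteq>?J. orth A ?E \<and> 2 * card A = card ?J"
  proof (rule exists_half_weight[OF E _ J])
    fix x assume "x \<in> ?E" "matched f x"
    then show "4 dvd card x" using c xJ by force
  qed (use finite_I in simp)
  then obtain A where A: "A \<subseteq> ?J" "orth A ?E" "2 * card A = card ?J" by blast
  have "A \<inter> (x \<inter> ?J) = A \<inter> x" for x using A(1) by blast
  then have "orth A E" using A(2) by (simp add: orth_def)
  moreover have "card ?J = 4 * k" using fa a finite_I card_I by (subst card_Diff_subset) auto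
  ultimately show False using free[of A] A by auto
qed

text \<open>
  Suppose all words are even and choose a matching with the fewest matched words. By
  \<open>card_ge_if_matched\<close> there are at most four of them: the empty word, \<open>I\<close>, and possibly a
  word \<open>z\<close> and its complement. As \<open>card I\<close> is not divisible by four, exactly one word of each
  complementary pair has weight divisible by four. Removing a pair outside \<open>z\<close> or its
  complement, whichever that is, or any pair if there is no \<open>z\<close>, leaves only matched words
  with weights divisible by four, which contradicts \<open>exists_near_matched_word\<close>.
\<close>

lemma exists_odd_word: "\<exists>x\<in>E. odd (card x)"
proof (rule ccontr)
  assume "\<not> ?thesis"
  then have ev: "\<And>x. x \<in> E \<Longrightarrow> even (card x)" by blast
  define K where "K f = {x \<in> E. matched f x}" for f
  obtain f where f: "matching I f" and min: "\<And>g. matching I g \<Longrightarrow> card (K f) \<le> card (K g)"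
    using ex_has_least_nat[of "matching I" _ "\<lambda>f. card (K f)"] exists_matching[OF finite_I] card_I
    by (metis even_add even_mult_iff even_numeral)
  have fin: "finite (K f)" using finite_binary_code[OF code finite_I] by (simp add: K_def)
  have IK: "I \<in> K f" using I_in f by (auto simp: K_def matched_def matching_def)
  have Kc: "I - x \<in> K f" if "x \<in> K f" for x
    using that E_compl matched_iff[OF f _ E_sub] matchingD[OF f]
    unfolding K_def matched_def by blast
  have "\<exists>z\<in>K f. 4 dvd card z \<and> K f \<subseteq> {{}, I, z, I - z}"
  proof (cases "\<exists>z\<in>K f. z \<noteq> {} \<and> z \<noteq> I")
    case False
    then show ?thesis
      using binary_codeD(2)[OF code] by (intro bexI[of _ "{}"]) (auto simp: K_def matched_def)
  next
    case True
    then obtain z where z: "z \<in> K f" "z \<noteq> {}" "z \<noteq> I" by blast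
    have zI: "z \<subseteq> I" using z(1) E_sub by (simp add: K_def)
    let ?S = "{{}, I, z, I - z}"
    have S: "?S \<subseteq> K f" using z IK Kc[OF IK] Kc[OF z(1)] by simp
    have "card (K f) * 2 ^ (2 * k) \<le> 2 ^ (2 * k + 2)"
      using card_ge_if_matched[OF code finite_I f min[unfolded K_def] _ _ z(2,3)] z(1) card_reps[OF f]
      by (intro le_trans[OF _ card_E]) (simp add: K_def)
    then have "card (K f) \<le> 4" by simp
    moreover have "card ?S = 4" using z zI by (auto simp: card_insert_if)
    ultimately have "K f = ?S" using S fin by (metis card_seteq)
    moreover have "card z + card (I - z) = 4 * k + 2"
      using zI finite_I card_I by (metis card_Diff_subset card_mono finite_subset le_add_diff_inverse)
    moreover have "even (card z)" "even (card (I - z))" using ev S by (auto simp: K_def)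
    ultimately have "4 dvd card z \<or> 4 dvd card (I - z)" by presburger
    moreover have "I - (I - z) = z" using zI by blast
    ultimately show ?thesis using z(1) Kc[OF z(1)] \<open>K f = ?S\<close> by auto
  qed
  then obtain z where z: "z \<in> K f" "4 dvd card z" "K f \<subseteq> {{}, I, z, I - z}" by blast
  have zI: "z \<subseteq> I" using z(1) E_sub by (simp add: K_def)
  have "z \<noteq> I" using z(2) card_I by (auto simp: dvd_def) presburger
  then obtain a where a: "a \<in> I" "a \<notin> z" using zI by blast
  obtain x where x: "x \<in> E" "matched f (x - {a, f a})" "\<not> 4 dvd card (x - {a, f a})"
    using exists_near_matched_word[OF f a(1)] by blast
  note fa = matchingD[OF f a(1)]
  have faz: "f a \<notin> z" using z(1) a fa by (auto simp: K_def matched_def)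
  have cJ: "card (I - {a, f a}) = 4 * k" using fa a finite_I card_I by (subst card_Diff_subset) auto
  have "even (card (x - {a, f a}))"
    using card_matched[OF f finite_I _ x(2)] E_sub[OF x(1)] by (metis Diff_subset dvd_triv_left order_trans)
  moreover have "card x = card (x - {a, f a}) + of_bool (a \<in> x) + of_bool (f a \<in> x)"
  proof -
    have "card x = card (x - {a, f a}) + card (x \<inter> {a, f a})"
      using E_fin[OF x(1)] by (subst card_Un_disjoint[symmetric]) (auto intro: arg_cong[where f = card])
    also have "x \<inter> {a, f a} = (if a \<in> x then {a} else {}) \<union> (if f a \<in> x then {f a} else {})" by auto
    finally show ?thesis using fa by simp
  qed
  ultimately have "a \<in> x \<longleftrightarrow> f a \<in> x" using ev[OF x(1)] by (auto split: if_splits)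
  then have "matched f x" using x(2) fa unfolding matched_def by (metis DiffD1 DiffI insert_iff singletonD)
  then have "x \<in> K f" using x(1) by (simp add: K_def)
  then consider "x = {}" | "x = I" | "x = z" | "x = I - z" using z(3) by blast
  then have "4 dvd card (x - {a, f a})"
  proof cases
    case 4
    have "x - {a, f a} = (I - {a, f a}) - z" using 4 by blast
    moreover have "card \<dots> = 4 * k - card z"
      unfolding cJ[symmetric] using zI a faz finite_I by (intro card_Diff_subset) (auto intro: finite_subset)
    ultimately show ?thesis using z(2) by simp
  qed (use cJ z(2) a faz in auto)
  then show False using x(3) by blast
qed

text \<open>
  The even words form a subcode of index two, which is too small for a nontrivial matched word
  by \<open>card_ge_if_matched\<close>. So the words from \<open>exists_near_matched_word\<close> are not matched: they
  split the removed pair.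
\<close>

lemma exists_splitting_words:
  "\<exists>f y. matching I f \<and> (\<forall>x\<in>E. matched f x \<longrightarrow> x = {} \<or> x = I)
    \<and> (\<forall>a\<in>I. y a \<in> E \<and> (\<forall>i\<in>I. (i \<in> y a) \<noteq> (f i \<in> y a) \<longleftrightarrow> i \<in> {a, f a})
        \<and> \<not> 4 dvd card (y a - {a, f a}))"
proof -
  define W where "W = {x \<in> E. even (card x)}"
  have W: "binary_code I W" unfolding W_def
  proof (rule binary_code_Collect[OF code])
    fix x y assume "x \<in> E" "y \<in> E" "even (card x)" "even (card y)"
    moreover from this have "I \<inter> (x \<triangle> y) = x \<triangle> y" "I \<inter> x = x" "I \<inter> y = y" using E_sub by blast+
    ultimately show "even (card (x \<triangle> y))" using even_card_inter_sdiff[OF finite_I, of x y] by simp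
  qed simp
  have card_W: "card W \<le> 2 ^ (2 * k + 1)"
  proof -
    obtain u where u: "u \<in> E" "odd (card u)" using exists_odd_word by blast
    have "inj_on (\<lambda>x. x \<triangle> u) W" by (rule inj_on_inverseI[where g = "\<lambda>x. x \<triangle> u"]) (rule sdiff_cancel)
    then have "card ((\<lambda>x. x \<triangle> u) ` W) = card W" by (rule card_image)
    moreover have "(\<lambda>x. x \<triangle> u) ` W \<subseteq> E - W"
    proof
      fix w assume "w \<in> (\<lambda>x. x \<triangle> u) ` W"
      then obtain x where x: "x \<in> W" "w = x \<triangle> u" by blast
      then have "x \<in> E" by (simp add: W_def)
      then have "I \<inter> (x \<triangle> u) = x \<triangle> u" "I \<inter> x = x" "I \<inter> u = u" using u E_sub by blast+
      then have "odd (card w)" using even_card_inter_sdiff[OF finite_I, of x u] x u by (simp add: W_def)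
      moreover have "w \<in> E" using binary_codeD(3)[OF code \<open>x \<in> E\<close> u(1)] x by simp
      ultimately show "w \<in> E - W" by (simp add: W_def)
    qed
    moreover have "finite E" by (rule finite_binary_code[OF code finite_I])
    ultimately have "card W \<le> card (E - W)" by (metis card_mono finite_Diff)
    also have "\<dots> = card E - card W" using \<open>finite E\<close> by (intro card_Diff_subset) (auto simp: W_def)
    finally show ?thesis using card_E by simp
  qed
  define K where "K f = {x \<in> W. matched f x}" for f
  obtain f where f: "matching I f" and min: "\<And>g. matching I g \<Longrightarrow> card (K f) \<le> card (K g)"
    using ex_has_least_nat[of "matching I" _ "\<lambda>f. card (K f)"] exists_matching[OF finite_I] card_I
    by (metis even_add even_mult_iff even_numeral)
  have EK: "x \<in> K f" if "x \<in> E" "matched f x" for x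
    using that card_matched[OF f finite_I E_sub[OF that(1)]] by (simp add: K_def W_def)
  have mI: "matched f I" using f by (auto simp: matched_def matching_def)
  have triv: "x = {} \<or> x = I" if x: "x \<in> E" "matched f x" for x
  proof (rule ccontr)
    assume n: "\<not> ?thesis"
    have xI: "x \<subseteq> I" using E_sub x by blast
    let ?S = "{{}, I, x, I - x}"
    have "matched f (I - x)"
      using matched_iff[OF f x(2) xI] matchingD[OF f] unfolding matched_def by blast
    then have "?S \<subseteq> K f" using EK x I_in mI E_compl binary_codeD(2)[OF code] by (auto simp: matched_def)
    moreover have "card ?S = 4" using n xI by (auto simp: card_insert_if)
    moreover have "finite (K f)" using finite_binary_code[OF W finite_I] by (simp add: K_def)
    ultimately have "4 \<le> card (K f)" by (metis card_mono)
    then have "4 * 2 ^ (2 * k) \<le> card (K f) * 2 ^ (2 * k)" by simp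
    also have "\<dots> \<le> card W"
      using card_ge_if_matched[OF W finite_I f min[unfolded K_def] _ x(2)] EK[OF x] n card_reps[OF f]
      unfolding K_def by simp
    finally have "4 * 2 ^ (2 * k) \<le> card W" .
    moreover have "(0::nat) < 2 ^ (2 * k)" by simp
    ultimately show False using card_W unfolding power_add power_one_right by linarith
  qed
  have "\<forall>a\<in>I. \<exists>x. x \<in> E \<and> (\<forall>i\<in>I. (i \<in> x) \<noteq> (f i \<in> x) \<longleftrightarrow> i \<in> {a, f a}) \<and> \<not> 4 dvd card (x - {a, f a})"
    (is "\<forall>a\<in>I. ?P a")
  proof
    fix a assume a: "a \<in> I"
    obtain x where x: "x \<in> E" "matched f (x - {a, f a})" "\<not> 4 dvd card (x - {a, f a})"
      using exists_near_matched_word[OF f a] by blast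
    note fa = matchingD[OF f a]
    have cJ: "card (I - {a, f a}) = 4 * k" using fa a finite_I card_I by (subst card_Diff_subset) auto
    have "x - {a, f a} \<subseteq> I" using E_sub x by blast
    note m = matched_iff[OF f x(2) this]
    have nm: "\<not> matched f x"
    proof
      assume "matched f x"
      then have "x = {} \<or> x = I" using triv x by blast
      then show False using x(3) cJ by auto
    qed
    have other: "i \<in> x \<longleftrightarrow> f i \<in> x" if i: "i \<in> I" "i \<notin> {a, f a}" for i
      using m[OF i(1)] matchingD[OF f i(1)] fa i(2) by auto
    have "(a \<in> x) \<noteq> (f a \<in> x)"
    proof
      assume "a \<in> x \<longleftrightarrow> f a \<in> x"
      then have "f i \<in> x" if "i \<in> x" for i
        using that other[of i] fa(3) E_sub[OF x(1)] by (cases "i \<in> {a, f a}") auto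
      then have "matched f x" by (simp add: matched_def)
      then show False using nm by blast
    qed
    then have "(i \<in> x) \<noteq> (f i \<in> x) \<longleftrightarrow> i \<in> {a, f a}" if "i \<in> I" for i
      using other[OF that] fa by auto
    then show "?P a" using x by blast
  qed
  from bchoice[OF this] obtain y where
    "\<forall>a\<in>I. y a \<in> E \<and> (\<forall>i\<in>I. (i \<in> y a) \<noteq> (f i \<in> y a) \<longleftrightarrow> i \<in> {a, f a})
      \<and> \<not> 4 dvd card (y a - {a, f a})" ..
  then show ?thesis using f triv by blast
qed

end

text \<open>
  The pairs, represented by the set \<open>T\<close>, are the vertices of a digraph, with an arc from \<open>r\<close>
  to \<open>s\<close> if \<open>y r\<close> contains the pair of \<open>s\<close>.
\<close>

locale splitting_words = midweight_free +
  fixes f :: "nat \<Rightarrow> nat" and y :: "nat \<Rightarrow> nat set"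
  assumes f: "matching I f"
    and matched_trivial: "x \<in> E \<Longrightarrow> matched f x \<Longrightarrow> x = {} \<or> x = I"
    and y_in: "a \<in> I \<Longrightarrow> y a \<in> E"
    and y_splits: "a \<in> I \<Longrightarrow> i \<in> I \<Longrightarrow> (i \<in> y a) \<noteq> (f i \<in> y a) \<longleftrightarrow> i \<in> {a, f a}"
    and y_card: "a \<in> I \<Longrightarrow> \<not> 4 dvd card (y a - {a, f a})"
begin

abbreviation T :: "nat set" where "T \<equiv> reps I f"

abbreviation Y :: "nat \<Rightarrow> nat \<Rightarrow> bool" where "Y r s \<equiv> s \<in> y r"

lemma T_sub: "r \<in> T \<Longrightarrow> r \<in> I" by (simp add: reps_def)

lemma T_partner: "r \<in> T \<Longrightarrow> f r \<notin> T" using matchingD(3)[OF f] by (auto simp: reps_def)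

lemma finite_T: "finite T" using finite_I by (simp add: reps_def)

lemma card_T: "card T = 2 * k + 1" by (rule card_reps[OF f])

lemma matched_y: "a \<in> I \<Longrightarrow> matched f (y a - {a, f a})"
  unfolding matched_def using y_splits E_sub[OF y_in] matchingD[OF f]
  by (metis DiffD1 DiffD2 DiffI insert_iff singletonD subsetD)

lemma odd_outdeg: assumes r: "r \<in> T" shows "odd (outdeg Y T r)"
proof -
  have "T \<inter> (y r - {r, f r}) = {s \<in> T - {r}. Y r s}" using T_partner[OF r] by blast
  then have "card (y r - {r, f r}) = 2 * outdeg Y T r"
    using card_matched[OF f finite_I _ matched_y[OF T_sub[OF r]]] E_sub[OF y_in[OF T_sub[OF r]]]
    by (auto simp: outdeg_def)
  then show ?thesis using y_card[OF T_sub[OF r]] by (auto simp: dvd_def)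
qed

text \<open>
  Let \<open>U\<close> be the set of pairs that \<open>A\<close> does not split. For \<open>r\<close> in \<open>U\<close>, orthogonality to \<open>y r\<close>
  decides whether \<open>A\<close> contains or avoids the pair \<open>r\<close>: the pair contributes one to the
  intersection if it is contained, each pair split by \<open>A\<close> and contained in \<open>y r\<close> contributes
  one, and all other pairs contribute an even number. As the out-degree of \<open>r\<close> in \<open>T\<close> is odd,
  \<open>r\<close> is contained in \<open>A\<close> precisely if its out-degree in \<open>U\<close> is even.
\<close>

lemma dual_word:
  assumes A: "A \<subseteq> I" "orth A E"
  defines "U \<equiv> {r \<in> T. r \<in> A \<longleftrightarrow> f r \<in> A}"
  shows "card A + 2 * odd_vertices Y U = 2 * k + 1 + card U"
proof -
  have fin: "finite U" "finite (T - U)" using finite_T by (simp_all add: U_def)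
  have UT: "U \<subseteq> T" by (auto simp: U_def)
  have iff: "r \<in> A \<longleftrightarrow> even (outdeg Y U r)" if r: "r \<in> U" for r
  proof -
    have rT: "r \<in> T" using r UT by blast
    define t :: "nat \<Rightarrow> nat"
      where "t s = of_bool (s \<in> A \<inter> y r) + of_bool (f s \<in> A \<inter> y r)" for s
    have t: "odd (t s) \<longleftrightarrow> s \<in> (if r \<in> A then {r} else {}) \<union> {s \<in> T - U. Y r s}" if s: "s \<in> T" for s
    proof (cases "s = r")
      case True
      then show ?thesis using r y_splits[OF T_sub[OF rT] T_sub[OF rT]] by (auto simp: U_def t_def)
    next
      case False
      then have "s \<notin> {r, f r}" using s T_partner[OF rT] by auto
      then have "s \<in> y r \<longleftrightarrow> f s \<in> y r" using y_splits[OF T_sub[OF rT] T_sub[OF s]] by blast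
      then show ?thesis using False s by (auto simp: U_def t_def)
    qed
    have "{s \<in> T. odd (t s)} = (if r \<in> A then {r} else {}) \<union> {s \<in> T - U. Y r s}"
      (is "_ = ?R")
    proof -
      have "?R \<subseteq> T" using rT by auto
      then show ?thesis using t by blast
    qed
    moreover have "even (card (A \<inter> y r))" using A(2) y_in[OF T_sub[OF rT]] by (simp add: orth_def)
    then have "even (\<Sum>s\<in>T. t s)"
      using card_by_pairs[OF f finite_I, of "A \<inter> y r"] A(1) unfolding t_def by (metis le_infI1)
    ultimately have "even (card ((if r \<in> A then {r} else {}) \<union> {s \<in> T - U. Y r s}))"
      by (simp add: even_sum_iff[OF finite_T])
    then have *: "r \<in> A \<longleftrightarrow> odd (card {s \<in> T - U. Y r s})" using r fin by (auto split: if_splits)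
    have "outdeg Y T r = outdeg Y U r + card {s \<in> T - U. Y r s}"
      unfolding outdeg_def using fin UT r
      by (subst card_Un_disjoint[symmetric]) (auto intro!: arg_cong[where f = card])
    then show ?thesis using * odd_outdeg[OF rT] by presburger
  qed
  have "card A = (\<Sum>r\<in>T. of_bool (r \<in> A) + of_bool (f r \<in> A))"
    by (rule card_by_pairs[OF f finite_I A(1)])
  also have "\<dots> = (\<Sum>r\<in>T. of_bool (r \<in> T - U) + 2 * of_bool (r \<in> {r \<in> U. r \<in> A}))"
    by (rule sum.cong) (auto simp: U_def)
  also have "\<dots> = card (T - U) + 2 * card {r \<in> U. r \<in> A}"
  proof -
    have "T \<inter> (T - U) = T - U" "T \<inter> {r \<in> U. r \<in> A} = {r \<in> U. r \<in> A}" using UT by blast+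
    then show ?thesis using finite_T by (simp add: sum.distrib sum_distrib_left[symmetric] Int_def)
  qed
  also have "{r \<in> U. r \<in> A} = {r \<in> U. even (outdeg Y U r)}" using iff by blast
  also have "card \<dots> = card U - odd_vertices Y U"
    unfolding odd_vertices_def using fin by (subst card_Diff_subset[symmetric]) (auto intro: arg_cong[where f = card])
  finally have "card A = card (T - U) + 2 * (card U - odd_vertices Y U)" .
  moreover have "odd_vertices Y U \<le> card U" unfolding odd_vertices_def using fin by (intro card_mono) auto
  moreover have "card (T - U) + card U = 2 * k + 1"
    using UT finite_T card_T by (metis card_Diff_subset card_mono finite_subset le_add_diff_inverse2)
  ultimately show ?thesis by simp
qed

text \<open>
  Some dual word splits precisely the pairs outside \<open>U\<close>, since these are even in number and
  the only nonempty matched word is \<open>I\<close>. Equality would give it weight \<open>2 * k\<close>.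
\<close>

lemma forbidden_odd_vertices:
  assumes U: "U \<subseteq> T" "odd (card U)"
  shows "2 * odd_vertices Y U \<noteq> card U + 1"
proof -
  let ?S = "T - U"
  have "card ?S + card U = 2 * k + 1"
    using U finite_T card_T by (metis card_Diff_subset card_mono finite_subset le_add_diff_inverse2)
  then have ev: "even (card ?S)" using U(2) by (metis even_add even_mult_iff even_numeral odd_one)
  have SI: "?S \<subseteq> I" using T_sub by blast
  have "even (card (?S \<inter> x))" if "x \<in> E" "matched f x" for x
    using matched_trivial[OF that] ev SI by (auto simp: Int_absorb2)
  from exists_matched_shift[OF code finite_I f SI this]
  obtain B where B: "B \<subseteq> I" "matched f B" "orth (?S \<triangle> B) E" by blast
  have A: "?S \<triangle> B \<subseteq> I" using SI B by blast
  have "{r \<in> T. r \<in> ?S \<triangle> B \<longleftrightarrow> f r \<in> ?S \<triangle> B} = U"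
    using matched_iff[OF f B(2,1)] T_sub T_partner U(1) by blast
  then show ?thesis using dual_word[OF A B(3)] free[OF A B(3)] by simp
qed

sublocale avoiding_digraph T Y
  by unfold_locales (use finite_T card_T odd_outdeg forbidden_odd_vertices in auto)

lemma odd_k: "odd k"
proof -
  have "{r \<in> T. odd (outdeg Y T r)} = T" using odd_outdeg by blast
  then have "odd_vertices Y T = 2 * k + 1" using card_T by (simp add: odd_vertices_def)
  then show ?thesis using odd_vertices_parity[OF subset_refl] card_T by simp
qed

lemma doubly_even:
  assumes A: "A \<subseteq> I" "orth A E"
  shows "4 dvd card A"
proof -
  let ?U = "{r \<in> T. r \<in> A \<longleftrightarrow> f r \<in> A}"
  note e = dual_word[OF A]
  have "odd c" if "even a" "a + 2 * v = 2 * k + 1 + c" for a v c :: nat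
    using that by presburger
  moreover have "even (card A)" using A I_in by (auto simp: orth_def Int_absorb2)
  ultimately have o: "odd (card ?U)" using e by blast
  then obtain h where h: "card ?U = 2 * h + 1" by (elim oddE)
  have "odd (odd_vertices Y ?U) \<longleftrightarrow> odd h" using odd_vertices_parity[OF Collect_restrict o] unfolding h by simp
  moreover have "4 dvd a" if "a + 2 * v = 2 * k + 1 + (2 * h + 1)" "odd v \<longleftrightarrow> odd h" for a v
  proof -
    obtain m where m: "k = 2 * m + 1" using odd_k by (elim oddE)
    have "v mod 2 = h mod 2" using that(2) by presburger
    then obtain p q b where "v = 2 * p + b" "h = 2 * q + b" by (metis mult_div_mod_eq)
    then have "a + 4 * p = 4 * (m + 1 + q)" using that(1) m by simp
    then have "4 dvd a + 4 * p" by simp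
    then show ?thesis by (simp add: dvd_add_left_iff)
  qed
  ultimately show ?thesis using e unfolding h by blast
qed

text \<open>
  Adding \<open>{i}\<close> to \<open>y i\<close> gives a matched word, hence the empty word or \<open>I\<close>. But then \<open>y i\<close> has,
  outside the pair of \<open>i\<close>, weight \<open>0\<close> or \<open>4 * k\<close>.
\<close>

lemma no_singleton:
  assumes i: "i \<in> I"
  shows "{i} \<notin> E"
proof
  assume s: "{i} \<in> E"
  note fi = matchingD[OF f i]
  have "y i \<triangle> {i} \<in> E" using binary_codeD(3)[OF code y_in[OF i] s] .
  moreover have "matched f (y i \<triangle> {i})"
    unfolding matched_def
  proof
    fix j assume j: "j \<in> y i \<triangle> {i}"
    then have jI: "j \<in> I" using E_sub[OF y_in[OF i]] i by blast
    show "f j \<in> y i \<triangle> {i}"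
      using y_splits[OF i jI] j fi matchingD(2,3)[OF f jI] by (cases "j = i"; cases "j = f i") auto
  qed
  ultimately have "y i \<triangle> {i} = {} \<or> y i \<triangle> {i} = I" by (rule matched_trivial)
  then have "y i - {i, f i} = {} \<or> y i - {i, f i} = I - {i, f i}" by blast
  moreover have "card (I - {i, f i}) = 4 * k" using fi i finite_I card_I by (subst card_Diff_subset) auto
  ultimately have "4 dvd card (y i - {i, f i})" by (elim disjE) (simp_all only: card.empty dvd_0_right dvd_triv_left)
  then show False using y_card[OF i] by simp
qed

end

context midweight_free
begin

lemma exists_splitting: "\<exists>f y. splitting_words I E k f y"
  using exists_splitting_words midweight_free_axioms
  unfolding splitting_words_def splitting_words_axioms_def by blast

lemma odd_k: "odd k"
  using exists_splitting splitting_words.odd_k by blast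

lemma doubly_even: "A \<subseteq> I \<Longrightarrow> orth A E \<Longrightarrow> 4 dvd card A"
  using exists_splitting splitting_words.doubly_even by blast

lemma no_singleton: "i \<in> I \<Longrightarrow> {i} \<notin> E"
  using exists_splitting splitting_words.no_singleton by blast

end

section \<open>Upper bounds\<close>

text \<open>
  The set \<open>H j\<close> consists of the positions where the \<open>j\<close>-th coordinate of a sequence is one.
  Then \<open>hits\<close> says that the sequence has a zero-sum subsequence of length \<open>r\<close>, and \<open>balanced\<close>
  that it is zero-sum.
\<close>

definition hits :: "nat \<Rightarrow> nat \<Rightarrow> nat \<Rightarrow> (nat \<Rightarrow> nat set) \<Rightarrow> bool" where
  "hits n d r H \<longleftrightarrow> (\<exists>A\<subseteq>{..<n}. card A = r \<and> (\<forall>j<d. even (card (A \<inter> H j))))"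

definition balanced :: "nat \<Rightarrow> nat \<Rightarrow> (nat \<Rightarrow> nat set) \<Rightarrow> bool" where
  "balanced n d H \<longleftrightarrow> (\<forall>j<d. even (card ({..<n} \<inter> H j)))"

lemma exists_span:
  assumes "finite I"
  shows "\<exists>E. binary_code I E \<and> I \<in> E \<and> card E \<le> 2 ^ (d + 1)
    \<and> (\<forall>A\<subseteq>I. orth A E \<longleftrightarrow> even (card A) \<and> (\<forall>j<d. even (card (A \<inter> H j))))"
proof (induction d)
  case 0
  have "binary_code I {{}, I}" by (auto simp: binary_code_def)
  moreover have "card {{}, I} \<le> 2" by (simp add: card_insert_if)
  ultimately show ?case by (intro exI[of _ "{{}, I}"]) (auto simp: orth_def Int_absorb2)
next
  case (Suc d)
  then obtain E where E: "binary_code I E" "I \<in> E" "card E \<le> 2 ^ (d + 1)"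
    and orth: "\<And>A. A \<subseteq> I \<Longrightarrow> orth A E \<longleftrightarrow> even (card A) \<and> (\<forall>j<d. even (card (A \<inter> H j)))" by blast
  define z where "z = H d \<inter> I"
  let ?E = "E \<union> (\<lambda>x. x \<triangle> z) ` E"
  have finE: "finite E" by (rule finite_binary_code[OF E(1) assms])
  have "binary_code I ?E"
    unfolding binary_code_def
  proof (intro conjI ballI)
    show "?E \<subseteq> Pow I" using binary_codeD(1)[OF E(1)] by (auto simp: z_def)
    show "{} \<in> ?E" using binary_codeD(2)[OF E(1)] by blast
    fix x y assume "x \<in> ?E" "y \<in> ?E"
    then obtain u v where uv: "u \<in> E" "v \<in> E" "x = u \<or> x = u \<triangle> z" "y = v \<or> y = v \<triangle> z" by blast
    have uvE: "u \<triangle> v \<in> E" by (rule binary_codeD(3)[OF E(1) uv(1,2)])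
    have "(u \<triangle> z) \<triangle> v = (u \<triangle> v) \<triangle> z" "u \<triangle> (v \<triangle> z) = (u \<triangle> v) \<triangle> z"
      "(u \<triangle> z) \<triangle> (v \<triangle> z) = u \<triangle> v" by blast+
    then have "x \<triangle> y = u \<triangle> v \<or> x \<triangle> y = (u \<triangle> v) \<triangle> z"
      using uv(3,4) by (elim disjE) simp_all
    then show "x \<triangle> y \<in> ?E"
    proof
      assume eq: "x \<triangle> y = u \<triangle> v"
      show ?thesis unfolding eq using uvE by (rule UnI1)
    next
      assume eq: "x \<triangle> y = (u \<triangle> v) \<triangle> z"
      show ?thesis unfolding eq using imageI[OF uvE] by (rule UnI2)
    qed
  qed
  moreover have "card ?E \<le> 2 ^ (Suc d + 1)"
    using E(3) card_Un_le[of E "(\<lambda>x. x \<triangle> z) ` E"] card_image_le[OF finE, of "\<lambda>x. x \<triangle> z"] by simp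
  moreover have "orth A ?E \<longleftrightarrow> even (card A) \<and> (\<forall>j<Suc d. even (card (A \<inter> H j)))" if A: "A \<subseteq> I" for A
  proof -
    have "A \<inter> z = A \<inter> H d" using A by (auto simp: z_def)
    then have "even (card (A \<inter> (x \<triangle> z))) \<longleftrightarrow> (even (card (A \<inter> x)) \<longleftrightarrow> even (card (A \<inter> H d)))" for x
      using even_card_inter_sdiff[OF finite_subset[OF A assms], of x z] by simp
    then have "orth A ?E \<longleftrightarrow> orth A E \<and> even (card (A \<inter> H d))"
      using binary_codeD(2)[OF E(1)] unfolding orth_def by auto
    then show ?thesis using orth[OF A] by (auto simp: less_Suc_eq)
  qed
  ultimately show ?case using E(2) by blast
qed

text \<open>
  Dual words that live on a part \<open>J\<close> of the positions are the dual words of the code \<open>E\<close>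
  restricted to \<open>J\<close>.
\<close>

lemma midweight_word_shortened:
  fixes I :: "nat set"
  assumes "finite I" "binary_code I E" "I \<in> E" "card E \<le> 2 ^ (2 * k + 2)"
    and J: "J \<subseteq> I" "card J = 4 * k + 2"
    and free: "\<And>A. A \<subseteq> J \<Longrightarrow> orth A E \<Longrightarrow> card A \<noteq> 2 * k"
  shows "odd k" and "\<And>A. A \<subseteq> J \<Longrightarrow> orth A E \<Longrightarrow> 4 dvd card A"
    and "\<And>i. {i} \<in> E \<Longrightarrow> i \<notin> J"
proof -
  let ?E = "(\<lambda>x. x \<inter> J) ` E"
  have orth: "orth A ?E \<longleftrightarrow> orth A E" if "A \<subseteq> J" for A
  proof -
    have "A \<inter> (x \<inter> J) = A \<inter> x" for x using that by blast
    then show ?thesis by (simp add: orth_def)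
  qed
  interpret midweight_free J ?E k
  proof
    show "finite J" using J assms(1) finite_subset by blast
    show "binary_code J ?E"
      using binary_code_puncture[OF assms(2), of J] J(1) by (simp add: Int_absorb1)
    show "J \<in> ?E" using assms(3) J(1) by blast
    have "card ?E \<le> card E" by (rule card_image_le[OF finite_binary_code[OF assms(2,1)]])
    then show "card ?E \<le> 2 ^ (2 * k + 2)" using assms(4) by simp
  qed (use free orth J in auto)
  show "odd k" by (rule odd_k)
  show "4 dvd card A" if "A \<subseteq> J" "orth A E" for A using doubly_even that orth by blast
  show "i \<notin> J" if "{i} \<in> E" for i
  proof
    assume i: "i \<in> J"
    then have "{i} \<in> ?E" using that by (intro image_eqI[of _ _ "{i}"]) auto
    then show False using no_singleton[OF i] by blast
  qed
qed

text \<open>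
  The dual code is lengthened to \<open>4 * k\<close> positions, first by positions that no dual word uses,
  up to \<open>4 * k - 1\<close>, and then by one more position together with the all-one word. Its words
  of weight \<open>2 * k\<close> are those of the original dual and their complements in the \<open>4 * k\<close>
  positions. Two further unused positions give the length of \<open>midweight_free\<close>, where unused
  positions are impossible. Dually, the new code \<open>F\<close> consists of the sets that extend a word
  of \<open>E\<close>, have even weight on the first \<open>4 * k\<close> positions and are otherwise arbitrary.
\<close>

theorem hits_small_rank:
  assumes d: "d \<le> 2 * k - 1" and k: "k \<ge> 1"
  shows "hits (2 * k + d) d (2 * k) H"
proof -
  define n where "n = 2 * k + d"
  let ?I = "{..<n}" and ?J = "{..<4 * k + 2}"
  define N where "N = {n..<4 * k}"
  define e where "e = 4 * k - n"
  have n4: "n < 4 * k" using d k by (simp add: n_def)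
  obtain E where E: "binary_code ?I E" "?I \<in> E" "card E \<le> 2 ^ (d + 1)"
    and orth: "\<And>A. A \<subseteq> ?I \<Longrightarrow> orth A E \<longleftrightarrow> even (card A) \<and> (\<forall>j<d. even (card (A \<inter> H j)))"
    using exists_span[of ?I d H] by auto
  define F where "F = {x. x \<subseteq> ?J \<and> x \<inter> ?I \<in> E \<and> even (card (x \<inter> {..<4 * k}))}"
  have "binary_code ?J F" unfolding binary_code_def
  proof (intro conjI ballI)
    fix x y assume xy: "x \<in> F" "y \<in> F"
    have "(x \<triangle> y) \<inter> ?I = (x \<inter> ?I) \<triangle> (y \<inter> ?I)" by blast
    then show "x \<triangle> y \<in> F" using xy binary_codeD(3)[OF E(1)]
      by (auto simp: F_def even_card_sdiff_inter)
  qed (use binary_codeD(2)[OF E(1)] in \<open>auto simp: F_def\<close>)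
  moreover have "?J \<in> F"
  proof -
    have "?J \<inter> ?I = ?I" "?J \<inter> {..<4 * k} = {..<4 * k}" using n4 by auto
    then show ?thesis using E(2) by (simp add: F_def)
  qed
  moreover have "card F \<le> 2 ^ (2 * k + 2)"
  proof -
    \<comment> \<open>The even weight on the first \<open>4 * k\<close> positions determines whether \<open>n\<close> belongs to a word.\<close>
    let ?M = "{Suc n..<4 * k + 2}"
    have "inj_on (\<lambda>x. (x \<inter> ?I, x \<inter> ?M)) F"
    proof (rule inj_onI)
      fix x y assume xy: "x \<in> F" "y \<in> F" "(x \<inter> ?I, x \<inter> ?M) = (y \<inter> ?I, y \<inter> ?M)"
      have J: "?J = insert n (?I \<union> ?M)" using n4 by auto
      have xJ: "x \<subseteq> ?J" "y \<subseteq> ?J" using xy by (auto simp: F_def)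
      have eq: "i \<in> x \<longleftrightarrow> i \<in> y" if "i \<noteq> n" for i using xy(3) xJ that unfolding J by blast
      have "n \<in> x \<longleftrightarrow> n \<in> y"
      proof (rule ccontr)
        assume n: "(n \<in> x) \<noteq> (n \<in> y)"
        then have "x \<triangle> y = {n}" using eq by blast
        then have "(x \<triangle> y) \<inter> {..<4 * k} = {n}" using n4 by auto
        then show False
          using xy(1,2) even_card_sdiff_inter[of "{..<4 * k}" x y] by (simp add: F_def)
      qed
      then have "i \<in> x \<longleftrightarrow> i \<in> y" for i using eq[of i] by (cases "i = n") auto
      then show "x = y" by (rule Set.set_eqI)
    qed
    moreover have "(\<lambda>x. (x \<inter> ?I, x \<inter> ?M)) ` F \<subseteq> E \<times> Pow ?M" by (auto simp: F_def)
    moreover have "finite (E \<times> Pow ?M)" using finite_binary_code[OF E(1)] by simp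
    ultimately have "card F \<le> card (E \<times> Pow ?M)" by (rule card_inj_on_le)
    also have "\<dots> \<le> 2 ^ (d + 1) * 2 ^ (4 * k + 2 - Suc n)"
      using E(3) by (simp add: card_cartesian_product card_Pow)
    also have "\<dots> = 2 ^ (2 * k + 2)" using n4 by (simp add: n_def power_add[symmetric])
    finally show ?thesis .
  qed
  moreover have "{4 * k} \<in> F" using n4 binary_codeD(2)[OF E(1)] by (simp add: F_def)
  ultimately obtain A where A: "A \<subseteq> ?J" "orth A F" "card A = 2 * k"
    using midweight_word_shortened(3)[of ?J F k ?J "4 * k"] by auto
  have single: "i \<notin> A" if "i \<in> {4 * k, 4 * k + 1}" for i
  proof
    assume "i \<in> A"
    then have "A \<inter> {i} = {i}" by blast
    moreover have "{i} \<in> F" using that n4 binary_codeD(2)[OF E(1)] by (auto simp: F_def)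
    ultimately show False using A(2) by (auto simp: orth_def)
  qed
  have A4: "A \<subseteq> {..<4 * k}"
  proof
    fix i assume i: "i \<in> A"
    then have "i < 4 * k + 2" "i \<noteq> 4 * k" "i \<noteq> 4 * k + 1" using A(1) single[of i] by auto
    then show "i \<in> {..<4 * k}" by simp
  qed
  have finA: "finite A" using A(1) finite_subset by blast
  have same: "i \<in> A \<longleftrightarrow> n \<in> A" if "i \<in> {n..<4 * k}" for i
  proof (cases "i = n")
    case False
    have "{n, i} \<in> F" using that n4 False binary_codeD(2)[OF E(1)] by (auto simp: F_def Int_absorb2)
    then have "even (card (A \<inter> {n, i}))" using A(2) by (auto simp: orth_def)
    then show ?thesis using False by (auto simp: Int_insert_right split: if_splits)
  qed simp
  have ext: "\<exists>x\<in>F. x \<inter> ?I = w \<and> x \<subseteq> {..<4 * k}" if w: "w \<in> E" for w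
  proof (cases "even (card w)")
    case True
    have "w \<subseteq> ?I" by (rule binary_codeD(1)[OF E(1) w])
    moreover from this have "w \<inter> ?I = w" "w \<inter> {..<4 * k} = w" "w \<subseteq> {..<4 * k}" "w \<subseteq> ?J" using n4 by auto
    ultimately show ?thesis using True w by (intro bexI[of _ w]) (auto simp: F_def)
  next
    case False
    have wI: "w \<subseteq> ?I" by (rule binary_codeD(1)[OF E(1) w])
    then have "insert n w \<inter> ?I = w" "insert n w \<inter> {..<4 * k} = insert n w"
      "insert n w \<subseteq> {..<4 * k}" "insert n w \<subseteq> ?J" "n \<notin> w" "finite w" using n4 by (auto intro: finite_subset)
    then show ?thesis using False w by (intro bexI[of _ "insert n w"]) (auto simp: F_def)
  qed
  show ?thesis
  proof (cases "n \<in> A")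
    case False
    have AI: "A \<subseteq> ?I"
    proof
      fix i assume i: "i \<in> A"
      then show "i \<in> ?I" using A4 same[of i] False by (cases "i < n") auto
    qed
    have "orth A E" unfolding orth_def
    proof
      fix w assume "w \<in> E"
      then obtain x where x: "x \<in> F" "x \<inter> ?I = w" using ext by blast
      then have "A \<inter> w = A \<inter> x" using AI by blast
      then show "even (card (A \<inter> w))" using A(2) x(1) by (simp add: orth_def)
    qed
    then show ?thesis using orth[OF AI] A(3) AI unfolding hits_def n_def by blast
  next
    case True
    \<comment> \<open>All positions from \<open>n\<close> to \<open>4 * k - 1\<close> belong to \<open>A\<close>, so its complement there avoids them.\<close>
    let ?B = "{..<4 * k} - A"
    have BI: "?B \<subseteq> ?I"
    proof
      fix i assume i: "i \<in> ?B"
      then show "i \<in> ?I" using same[of i] True by (cases "i < n") auto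
    qed
    have cB: "card ?B = 2 * k" using A4 A(3) finA by (subst card_Diff_subset) auto
    have "orth ?B E" unfolding orth_def
    proof
      fix w assume "w \<in> E"
      then obtain x where x: "x \<in> F" "x \<inter> ?I = w" "x \<subseteq> {..<4 * k}" using ext by blast
      have "?B \<inter> w = ?B \<inter> x" using BI x by blast
      moreover have "x = (A \<inter> x) \<union> (?B \<inter> x)" using x(3) by blast
      then have "card x = card (A \<inter> x) + card (?B \<inter> x)"
        using finA by (subst card_Un_disjoint[symmetric]) auto
      moreover have "even (card x)" using x by (simp add: F_def Int_absorb2)
      moreover have "even (card (A \<inter> x))" using A(2) x(1) by (simp add: orth_def)
      ultimately show "even (card (?B \<inter> w))" by simp
    qed
    then show ?thesis using orth[OF BI] cB BI unfolding hits_def n_def by blast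
  qed
qed

text \<open>
  One unused position is added, which \<open>midweight_free\<close> does not tolerate.
\<close>

theorem hits_middle_rank: "hits (4 * k + 1) (2 * k) (2 * k) H"
proof -
  let ?I = "{..<4 * k + 1}" and ?J = "{..<4 * k + 2}"
  obtain E where E: "binary_code ?I E" "?I \<in> E" "card E \<le> 2 ^ (2 * k + 1)"
    and orth: "\<And>A. A \<subseteq> ?I \<Longrightarrow> orth A E \<longleftrightarrow> even (card A) \<and> (\<forall>j<2*k. even (card (A \<inter> H j)))"
    using exists_span[of ?I "2 * k" H] by auto
  define F where "F = E \<union> insert (4 * k + 1) ` E"
  have new: "4 * k + 1 \<notin> x" if "x \<in> E" for x using binary_codeD(1)[OF E(1) that] by auto
  have "binary_code ?J F" unfolding binary_code_def
  proof (intro conjI ballI)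
    show "F \<subseteq> Pow ?J"
    proof
      fix x assume "x \<in> F"
      then obtain u where "u \<in> E" "x \<subseteq> insert (4 * k + 1) u" by (auto simp: F_def)
      then show "x \<in> Pow ?J" using binary_codeD(1)[OF E(1), of u] by fastforce
    qed
    show "{} \<in> F" using binary_codeD(2)[OF E(1)] by (simp add: F_def)
    fix x y assume "x \<in> F" "y \<in> F"
    then obtain u v where uv: "u \<in> E" "v \<in> E" "x = u \<or> x = insert (4 * k + 1) u"
      "y = v \<or> y = insert (4 * k + 1) v" by (auto simp: F_def)
    have uvE: "u \<triangle> v \<in> E" by (rule binary_codeD(3)[OF E(1) uv(1,2)])
    have "insert p u \<triangle> v = insert p (u \<triangle> v)" "u \<triangle> insert p v = insert p (u \<triangle> v)"
      "insert p u \<triangle> insert p v = u \<triangle> v" if "p \<notin> u" "p \<notin> v" for p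
      using that by auto
    from this[OF new[OF uv(1)] new[OF uv(2)]]
    have "x \<triangle> y = u \<triangle> v \<or> x \<triangle> y = insert (4 * k + 1) (u \<triangle> v)"
      using uv(3,4) by (elim disjE) simp_all
    then show "x \<triangle> y \<in> F"
    proof
      assume eq: "x \<triangle> y = u \<triangle> v"
      show ?thesis unfolding eq F_def using uvE by (rule UnI1)
    next
      assume eq: "x \<triangle> y = insert (4 * k + 1) (u \<triangle> v)"
      show ?thesis unfolding eq F_def using imageI[OF uvE] by (rule UnI2)
    qed
  qed
  moreover have "insert (4 * k + 1) ?I = ?J" by auto
  then have "?J \<in> F" using E(2) by (auto simp: F_def)
  moreover have "finite E" by (rule finite_binary_code[OF E(1)]) simp
  then have "card F \<le> 2 ^ (2 * k + 2)"
    using E(3) card_Un_le[of E "insert (4 * k + 1) ` E"] card_image_le[of E "insert (4 * k + 1)"]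
    by (simp add: F_def)
  moreover have F1: "{4 * k + 1} \<in> F" using binary_codeD(2)[OF E(1)] by (auto simp: F_def)
  ultimately obtain A where A: "A \<subseteq> ?J" "orth A F" "card A = 2 * k"
    using midweight_word_shortened(3)[of ?J F k ?J "4 * k + 1"] by auto
  have "4 * k + 1 \<notin> A" using A(2) F1 by (auto simp: orth_def)
  then have AI: "A \<subseteq> ?I" using A(1) by (auto simp: less_Suc_eq)
  have "orth A E" using A(2) by (auto simp: orth_def F_def)
  then show ?thesis using orth[OF AI] AI A(3) unfolding hits_def by blast
qed

lemma hits_mono:
  assumes "hits n d r H" "n \<le> m"
  shows "hits m d r H"
proof -
  obtain A where A: "A \<subseteq> {..<n}" "card A = r \<and> (\<forall>j<d. even (card (A \<inter> H j)))"
    using assms(1) unfolding hits_def by blast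
  have "A \<subseteq> {..<m}" using A(1) assms(2) by auto
  then show ?thesis unfolding hits_def using A(2) by (intro exI[of _ A]) simp
qed

lemma hits_complement:
  assumes "hits n d r H" "balanced n d H"
  shows "hits n d (n - r) H"
proof -
  obtain A where A: "A \<subseteq> {..<n}" "card A = r" "\<And>j. j < d \<Longrightarrow> even (card (A \<inter> H j))"
    using assms(1) by (auto simp: hits_def)
  have fin: "finite A" using A(1) finite_subset by blast
  have "even (card (({..<n} - A) \<inter> H j))" if "j < d" for j
  proof -
    have "card ({..<n} \<inter> H j) = card (({..<n} - A) \<inter> H j) + card (A \<inter> H j)"
      using A(1) fin by (subst card_Un_disjoint[symmetric]) (auto intro: arg_cong[where f = card])
    then show ?thesis using assms(2) A(3)[OF that] that by (auto simp: balanced_def)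
  qed
  moreover have "card ({..<n} - A) = n - r" using A fin by (simp add: card_Diff_subset)
  ultimately show ?thesis unfolding hits_def by (intro exI[of _ "{..<n} - A"]) simp
qed

lemma exists_span_free:
  assumes "\<not> hits n d r H" "even r"
  obtains E where "binary_code {..<n} E" "{..<n} \<in> E" "card E \<le> 2 ^ (d + 1)"
    "\<And>A. A \<subseteq> {..<n} \<Longrightarrow> orth A E \<longleftrightarrow> even (card A) \<and> (\<forall>j<d. even (card (A \<inter> H j)))"
    "\<And>A. A \<subseteq> {..<n} \<Longrightarrow> orth A E \<Longrightarrow> card A \<noteq> r"
proof -
  obtain E where E: "binary_code {..<n} E" "{..<n} \<in> E" "card E \<le> 2 ^ (d + 1)"
    "\<And>A. A \<subseteq> {..<n} \<Longrightarrow> orth A E \<longleftrightarrow> even (card A) \<and> (\<forall>j<d. even (card (A \<inter> H j)))"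
    using exists_span[of "{..<n}" d H] by auto
  moreover have "card A \<noteq> r" if "A \<subseteq> {..<n}" "orth A E" for A
    using that assms(1) E(4)[OF that(1)] by (auto simp: hits_def)
  ultimately show ?thesis using that by blast
qed

theorem hits_top_rank_even:
  assumes "even k"
  shows "hits (4 * k + 2) (2 * k + 1) (2 * k) H"
proof (rule ccontr)
  assume "\<not> ?thesis"
  then obtain E where E: "binary_code {..<4 * k + 2} E" "{..<4 * k + 2} \<in> E" "card E \<le> 2 ^ (2 * k + 1 + 1)"
    "\<And>A. A \<subseteq> {..<4 * k + 2} \<Longrightarrow> orth A E \<Longrightarrow> card A \<noteq> 2 * k"
    using exists_span_free[of "4 * k + 2" "2 * k + 1" "2 * k" H] by (metis dvd_triv_left)
  then show False
    using midweight_word_shortened(1)[of "{..<4 * k + 2}" E k "{..<4 * k + 2}"] assms by simp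
qed

text \<open>
  If the complements, of weight \<open>2 * k\<close>, do not occur either, then all dual weights are
  divisible by four. But the dual contains the whole set of \<open>4 * k + 2\<close> positions.
\<close>

theorem balanced_hits_corank_one:
  assumes "balanced (4 * k + 2) (2 * k + 1) H"
  shows "hits (4 * k + 2) (2 * k + 1) (2 * k + 2) H"
proof (rule ccontr)
  assume n: "\<not> ?thesis"
  have "\<not> hits (4 * k + 2) (2 * k + 1) (2 * k) H"
  proof
    assume "hits (4 * k + 2) (2 * k + 1) (2 * k) H"
    from hits_complement[OF this assms] n show False by simp
  qed
  then obtain E where E: "binary_code {..<4 * k + 2} E" "{..<4 * k + 2} \<in> E" "card E \<le> 2 ^ (2 * k + 1 + 1)"
    and orth: "\<And>A. A \<subseteq> {..<4 * k + 2} \<Longrightarrow> orth A E \<longleftrightarrow> even (card A) \<and> (\<forall>j<2*k+1. even (card (A \<inter> H j)))"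
    and free: "\<And>A. A \<subseteq> {..<4 * k + 2} \<Longrightarrow> orth A E \<Longrightarrow> card A \<noteq> 2 * k"
    by (rule exists_span_free) auto
  have "orth {..<4 * k + 2} E" using orth[OF subset_refl] assms by (auto simp: balanced_def)
  then have "4 dvd card {..<4 * k + 2}"
    by (rule midweight_word_shortened(2)[OF _ E(1,2) _ subset_refl _ free subset_refl, rotated -1])
      (use E(3) in auto)
  then have "4 dvd 4 * k + 2" by simp
  then show False by presburger
qed

text \<open>
  Suppose no dual word has weight \<open>2 * k\<close>. Every dual word that leaves three positions free is
  a dual word for \<open>4 * k + 2\<close> positions, so its weight is divisible by four; a larger dual
  word has weight \<open>4 * k + 4\<close>. So any two dual words meet evenly, which bounds the square of
  their number by \<open>2 ^ (4 * k + 5)\<close>. But there are at least \<open>2 ^ (2 * k + 3)\<close> of them.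
\<close>

theorem hits_top_rank: "hits (4 * k + 5) (2 * k + 1) (2 * k) H"
proof (rule ccontr)
  assume n: "\<not> ?thesis"
  let ?I = "{..<4 * k + 5}"
  from n obtain E where E: "binary_code ?I E" "?I \<in> E" "card E \<le> 2 ^ (2 * k + 1 + 1)"
    and orth: "\<And>A. A \<subseteq> ?I \<Longrightarrow> orth A E \<longleftrightarrow> even (card A) \<and> (\<forall>j<2*k+1. even (card (A \<inter> H j)))"
    and free: "\<And>A. A \<subseteq> ?I \<Longrightarrow> orth A E \<Longrightarrow> card A \<noteq> 2 * k"
    by (rule exists_span_free) auto
  define C where "C = {A. A \<subseteq> ?I \<and> orth A E}"
  have "4 dvd card A" if A: "A \<in> C" for A
  proof -
    have AI: "A \<subseteq> ?I" "orth A E" using A by (auto simp: C_def)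
    have fin: "finite A" using AI(1) finite_subset by blast
    have cA: "card A \<le> 4 * k + 5" using card_mono[OF _ AI(1)] by simp
    have cd: "card (?I - A) = 4 * k + 5 - card A" using AI(1) fin by (simp add: card_Diff_subset)
    show ?thesis
    proof (cases "card A \<le> 4 * k + 2")
      case True
      then have "3 \<le> card (?I - A)" using cd by linarith
      then obtain S where S: "S \<subseteq> ?I - A" "card S = 3" "finite S"
        by (rule obtain_subset_with_card_n)
      have "S \<subseteq> ?I" using S(1) by blast
      then have "card (?I - S) = 4 * k + 2" using S by (simp add: card_Diff_subset)
      moreover have "A \<subseteq> ?I - S" using AI(1) S(1) by blast
      moreover have "card B \<noteq> 2 * k" if "B \<subseteq> ?I - S" "orth B E" for B
        using free that by blast
      ultimately show ?thesis
        using midweight_word_shortened(2)[of ?I E k "?I - S" A] E AI(2) by simp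
    next
      case False
      moreover have "even (card A)" using orth[OF AI(1)] AI(2) by blast
      ultimately have "card A = 4 * (k + 1)" using cA by presburger
      then show ?thesis by simp
    qed
  qed
  note four = this
  have C: "binary_code ?I C" unfolding C_def
    by (rule binary_code_dual) (use binary_codeD(1)[OF E(1)] in auto)
  have selforth: "orth A C" if A: "A \<in> C" for A unfolding orth_def
  proof
    fix B assume B: "B \<in> C"
    have fin: "finite A" "finite B" using A B finite_subset by (auto simp: C_def)
    have "card (A \<triangle> B) + 2 * card (A \<inter> B) = card A + card B"
    proof -
      have "card (A \<triangle> B) = card (A - B) + card (B - A)"
        using fin by (intro card_Un_disjoint) auto
      moreover have "card A = card (A - B) + card (A \<inter> B)" "card B = card (B - A) + card (A \<inter> B)"
        using fin by (subst card_Un_disjoint[symmetric]; auto intro: arg_cong[where f = card])+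
      ultimately show ?thesis by simp
    qed
    moreover have "4 dvd card (A \<triangle> B)" by (rule four[OF binary_codeD(3)[OF C A B]])
    moreover have "4 dvd card A + card B" using four[OF A] four[OF B] by simp
    ultimately have "4 dvd 2 * card (A \<inter> B)" by (metis dvd_add_right_iff)
    then show "even (card (A \<inter> B))" by presburger
  qed
  have "C \<subseteq> {A. A \<subseteq> ?I \<and> orth A C}" using selforth by (auto simp: C_def)
  then have "card C \<le> card {A. A \<subseteq> ?I \<and> orth A C}" by (intro card_mono) auto
  then have "card C * card C \<le> card C * card {A. A \<subseteq> ?I \<and> orth A C}" by (rule mult_le_mono2)
  also have "\<dots> = 2 ^ (4 * k + 5)" using card_dual[OF C] by simp
  finally have upper: "card C * card C \<le> 2 ^ (4 * k + 5)" .
  have "2 ^ (4 * k + 5) = card E * card C" using card_dual[OF E(1)] by (simp add: C_def)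
  also have "\<dots> \<le> 2 ^ (2 * k + 2) * card C" using E(3) by (intro mult_le_mono1) simp
  also have "(2::nat) ^ (4 * k + 5) = 2 ^ (2 * k + 2) * 2 ^ (2 * k + 3)"
    unfolding power_add[symmetric] by simp
  finally have "2 ^ (2 * k + 2) * 2 ^ (2 * k + 3) \<le> 2 ^ (2 * k + 2) * card C" .
  then have "2 ^ (2 * k + 3) \<le> card C"
    by (simp only: mult_le_cancel1 zero_less_power zero_less_numeral simp_thms)
  then have "2 ^ (2 * k + 3) * 2 ^ (2 * k + 3) \<le> card C * card C" by (rule mult_le_mono) fact
  then have "2 ^ (2 * k + 3) * 2 ^ (2 * k + 3) \<le> (2::nat) ^ (4 * k + 5)" using upper by (rule le_trans)
  moreover have "2 ^ (2 * k + 3) * 2 ^ (2 * k + 3) = 2 * (2::nat) ^ (4 * k + 5)"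
    by (simp add: power_add[symmetric] power_Suc[symmetric] del: power_Suc)
  ultimately show False by simp
qed

section \<open>Extremal sequences\<close>

text \<open>
  The sequence consists of \<open>2 * k - 1\<close> zeros and the \<open>d\<close> vectors of a basis.
\<close>

lemma not_hits_basis:
  assumes "k \<ge> 1"
  shows "\<not> hits (2 * k + d - 1) d (2 * k) (\<lambda>j. {2 * k - 1 + j})"
proof
  assume "hits (2 * k + d - 1) d (2 * k) (\<lambda>j. {2 * k - 1 + j})"
  then obtain A where A: "A \<subseteq> {..<2 * k + d - 1}" "card A = 2 * k"
    "\<And>j. j < d \<Longrightarrow> even (card (A \<inter> {2 * k - 1 + j}))" by (auto simp: hits_def)
  have "A \<subseteq> {..<2 * k - 1}"
  proof
    fix i assume i: "i \<in> A"
    show "i \<in> {..<2 * k - 1}"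
    proof (rule ccontr)
      assume "i \<notin> {..<2 * k - 1}"
      moreover have "i < 2 * k + d - 1" using i A(1) by auto
      ultimately have "i - (2 * k - 1) < d" "i = 2 * k - 1 + (i - (2 * k - 1))" using assms by auto
      then show False using A(3)[of "i - (2 * k - 1)"] i by (auto split: if_splits)
    qed
  qed
  then have "card A \<le> card {..<2 * k - 1}" by (intro card_mono) auto
  then show False using A(2) assms unfolding card_lessThan by linarith
qed

text \<open>
  The sequence consists of \<open>2 * k - 1\<close> zeros, the \<open>2 * k\<close> vectors of a basis and their sum, in
  the last position \<open>4 * k - 1\<close>. A zero-sum subsequence with a nonzero term contains all
  \<open>2 * k + 1\<close> nonzero terms.
\<close>

lemma not_hits_basis_sum:
  assumes k: "k \<ge> 1"
  defines "H \<equiv> \<lambda>j. {2 * k - 1 + j, 4 * k - 1}"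
  shows "balanced (4 * k) (2 * k) H" "\<not> hits (4 * k) (2 * k) (2 * k) H"
proof -
  have ne: "2 * k - 1 + j < 4 * k - 1" if "j < 2 * k" for j using that k by simp
  show "balanced (4 * k) (2 * k) H" unfolding balanced_def
  proof (intro allI impI)
    fix j assume j: "j < 2 * k"
    then have "{..<4 * k} \<inter> H j = {2 * k - 1 + j, 4 * k - 1}" using ne[OF j] by (auto simp: H_def)
    then show "even (card ({..<4 * k} \<inter> H j))" using ne[OF j] by simp
  qed
  show "\<not> hits (4 * k) (2 * k) (2 * k) H"
  proof
    assume "hits (4 * k) (2 * k) (2 * k) H"
    then obtain A where A: "A \<subseteq> {..<4 * k}" "card A = 2 * k"
      and even: "\<And>j. j < 2 * k \<Longrightarrow> even (card (A \<inter> H j))" by (auto simp: hits_def)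
    have fin: "finite A" using A(1) finite_subset by blast
    have same: "2 * k - 1 + j \<in> A \<longleftrightarrow> 4 * k - 1 \<in> A" if "j < 2 * k" for j
      using even[OF that] ne[OF that] by (auto simp: H_def Int_insert_right split: if_splits)
    have same': "i \<in> A \<longleftrightarrow> 4 * k - 1 \<in> A" if "2 * k - 1 \<le> i" "i < 4 * k" for i
    proof (cases "i = 4 * k - 1")
      case False
      then have "i - (2 * k - 1) < 2 * k" using that by simp
      from same[OF this] show ?thesis using that by simp
    qed simp
    show False
    proof (cases "4 * k - 1 \<in> A")
      case True
      then have "{2 * k - 1..<4 * k} \<subseteq> A" using same' by auto
      then have "card {2 * k - 1..<4 * k} \<le> card A" by (rule card_mono[OF fin])
      then show False using A(2) k by simp
    next
      case False
      have "A \<subseteq> {..<2 * k - 1}"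
      proof
        fix i assume "i \<in> A"
        then show "i \<in> {..<2 * k - 1}" using same'[of i] False A(1) by (cases "2 * k - 1 \<le> i") auto
      qed
      then have "card A \<le> card {..<2 * k - 1}" by (intro card_mono) auto
      then show False using A(2) k unfolding card_lessThan by linarith
    qed
  qed
qed

text \<open>
  The new term is a new basis vector.
\<close>

lemma not_hits_Suc:
  assumes "\<not> hits n d r H"
  shows "\<not> hits (Suc n) (Suc d) r (H(d := {n}))"
proof
  assume "hits (Suc n) (Suc d) r (H(d := {n}))"
  then obtain A where A: "A \<subseteq> {..<Suc n}" "card A = r"
    and even: "\<And>j. j < Suc d \<Longrightarrow> even (card (A \<inter> (H(d := {n})) j))" by (auto simp: hits_def)
  have "n \<notin> A" using even[of d] by auto
  then have "A \<subseteq> {..<n}" using A(1) by (auto simp: less_Suc_eq)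
  moreover have "even (card (A \<inter> H j))" if "j < d" for j using even[of j] that by simp
  ultimately show False using assms A(2) by (auto simp: hits_def)
qed

text \<open>
  The positions \<open>i\<close> and \<open>i + N\<close> form a pair for each \<open>i < N\<close>. The sets \<open>H j\<close>, with \<open>I\<close>, span
  the self-dual code that is generated by the unions of two pairs and by the set of all first
  elements. Its words either are unions of an even number of pairs, with weight divisible by
  four, or split every pair, with weight \<open>N\<close>.
\<close>

lemma not_hits_doubly_even:
  assumes N: "4 dvd N" "N > 0" and k: "odd k" "2 * k \<noteq> N"
  defines "H \<equiv> \<lambda>j. if j = N - 2 then {..<N} else {0, N, j + 1, j + 1 + N}"
  shows "balanced (2 * N) (N - 1) H" "\<not> hits (2 * N) (N - 1) (2 * k) H"
proof -
  have N4: "N \<ge> 4" using N by (auto dest: dvd_imp_le)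
  have evN: "even N" using N(1) by (meson dvd_trans even_numeral)
  show "balanced (2 * N) (N - 1) H" unfolding balanced_def
  proof (intro allI impI)
    fix j assume j: "j < N - 1"
    show "even (card ({..<2 * N} \<inter> H j))"
    proof (cases "j = N - 2")
      case True
      then have "{..<2 * N} \<inter> H j = {..<N}" by (auto simp: H_def)
      then show ?thesis using evN by simp
    next
      case False
      then have "{..<2 * N} \<inter> H j = {0, N, j + 1, j + 1 + N}" using j by (auto simp: H_def)
      then show ?thesis using j False N4 by (simp add: card_insert_if)
    qed
  qed
  show "\<not> hits (2 * N) (N - 1) (2 * k) H"
  proof
    assume "hits (2 * N) (N - 1) (2 * k) H"
    then obtain A where A: "A \<subseteq> {..<2 * N}" "card A = 2 * k"
      and even: "\<And>j. j < N - 1 \<Longrightarrow> even (card (A \<inter> H j))" by (auto simp: hits_def)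
    define f where "f m = (if m < N then m + N else m - N)" for m
    have f: "matching {..<2 * N} f" using N by (auto simp: matching_def f_def)
    have reps: "reps {..<2 * N} f = {..<N}" by (auto simp: reps_def f_def)
    \<comment> \<open>The set \<open>H j\<close> compares the pairs \<open>0\<close> and \<open>j + 1\<close>: all pairs but possibly the last meet \<open>A\<close> in the same parity, and as \<open>card A\<close> is even, so does the last.\<close>
    define t :: "nat \<Rightarrow> nat" where "t r = of_bool (r \<in> A) + of_bool (r + N \<in> A)" for r
    have cA: "card A = (\<Sum>r<N. t r)"
      unfolding card_by_pairs[OF f finite_lessThan A(1)] reps
      by (rule sum.cong) (auto simp: t_def f_def)
    have t0: "odd (t r) \<longleftrightarrow> odd (t 0)" if r: "r < N - 1" for r
    proof (cases "r = 0")
      case False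
      then have "H (r - 1) = {0, N, r, r + N}" using r by (auto simp: H_def)
      moreover have "card (A \<inter> {0, N, r, r + N}) = t 0 + t r"
        using False r N by (auto simp: t_def Int_insert_right)
      ultimately show ?thesis using even[of "r - 1"] r by auto
    qed simp
    have pe: "even (card {r \<in> {..<N}. odd (t r)})"
      using A(2) cA even_sum_iff[of "{..<N}" t] by (metis dvd_triv_left finite_lessThan)
    show False
    proof (cases "odd (t 0)")
      case True
      have "odd (t (N - 1))"
      proof (rule ccontr)
        assume "\<not> ?thesis"
        then have "odd (t r) \<longleftrightarrow> r < N - 1" if "r < N" for r
          using t0[of r] True that by (cases "r = N - 1") auto
        then have "{r \<in> {..<N}. odd (t r)} = {..<N - 1}"
          using less_trans[OF _ diff_less[OF zero_less_one N(2)]] by blast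
        then show False using pe evN N4 by simp
      qed
      then have "odd (t r)" if "r < N" for r
        using t0[of r] True that by (cases "r = N - 1") auto
      then have "t r = 1" if "r < N" for r using that by (fastforce simp: t_def)
      then have "card A = N" using cA by simp
      then show False using A(2) k by simp
    next
      case False
      have "even (t (N - 1))"
      proof (rule ccontr)
        assume "\<not> ?thesis"
        then have "odd (t r) \<longleftrightarrow> r = N - 1" if "r < N" for r
          using t0[of r] False that by (cases "r = N - 1") auto
        then have "{r \<in> {..<N}. odd (t r)} = {N - 1}"
          using diff_less[OF zero_less_one N(2)] by blast
        then show False using pe by simp
      qed
      then have ev: "even (t r)" if "r < N" for r
        using t0[of r] False that by (cases "r = N - 1") auto
      have same: "r \<in> A \<longleftrightarrow> r + N \<in> A" if "r < N" for r using ev[OF that] by (auto simp: t_def)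
      have "matched f A" unfolding matched_def
      proof
        fix i assume i: "i \<in> A"
        show "f i \<in> A"
        proof (cases "i < N")
          case True then show ?thesis using same i by (simp add: f_def)
        next
          case False
          then have "i - N < N" using i A(1) by auto
          then show ?thesis using same[of "i - N"] i False by (simp add: f_def)
        qed
      qed
      then have "card A = 2 * card ({..<N} \<inter> A)"
        using card_matched[OF f finite_lessThan A(1)] reps by simp
      moreover have "even (card (A \<inter> H (N - 2)))" using even[of "N - 2"] N4 by simp
      then have "even (card ({..<N} \<inter> A))" by (simp add: H_def Int_commute)
      ultimately show False using A(2) k by simp
    qed
  qed
qed

text \<open>
  Replacing \<open>H j\<close> by its complement adds one to the \<open>j\<close>-th coordinate of every term. For odd
  \<open>n\<close> this changes the \<open>j\<close>-th coordinate of the total sum.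
\<close>

lemma not_hits_odd_length:
  assumes H: "\<not> hits n d r H" and n: "odd n" and r: "even r"
  shows "\<exists>Z. balanced n d Z \<and> \<not> hits n d r Z"
proof -
  define Z where "Z j = (if even (card ({..<n} \<inter> H j)) then H j else {..<n} - H j)" for j
  have split: "card A = card (A \<inter> H j) + card (A \<inter> ({..<n} - H j))" if "A \<subseteq> {..<n}" for A j
    using finite_subset[OF that] that
    by (subst card_Un_disjoint[symmetric]) (auto intro: arg_cong[where f = card])
  have "balanced n d Z" unfolding balanced_def
  proof (intro allI impI)
    fix j
    have "even (card ({..<n} \<inter> ({..<n} - H j)))" if "odd (card ({..<n} \<inter> H j))"
    proof -
      have "n = card ({..<n} \<inter> H j) + card ({..<n} \<inter> ({..<n} - H j))" using split[of "{..<n}" j] by simp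
      then show ?thesis using n that by (metis even_add)
    qed
    then show "even (card ({..<n} \<inter> Z j))" by (simp add: Z_def)
  qed
  moreover have "\<not> hits n d r Z"
  proof
    assume "hits n d r Z"
    then obtain A where A: "A \<subseteq> {..<n}" "card A = r"
      and even: "\<And>j. j < d \<Longrightarrow> even (card (A \<inter> Z j))" by (auto simp: hits_def)
    have "even (card (A \<inter> H j))" if "j < d" for j
      using even[OF that] split[OF A(1), of j] A(2) r by (auto simp: Z_def split: if_splits)
    then show False using H A by (auto simp: hits_def)
  qed
  ultimately show ?thesis by blast
qed

section \<open>Sequences and families of sets\<close>

definition coord :: "(nat \<Rightarrow> int) list \<Rightarrow> nat \<Rightarrow> nat set" where
  "coord xs j = {i. i < length xs \<and> (xs ! i) j = 1}"

lemma finprod_Z2_pow: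
  assumes "finite A" "g \<in> A \<rightarrow> carrier (Z2_pow d)"
  shows "(\<Otimes>\<^bsub>Z2_pow d\<^esub>i\<in>A. g i) = (\<lambda>j\<in>{..<d}. (\<Sum>i\<in>A. g i j) mod 2)"
proof -
  interpret comm_group "Z2_pow d" by (rule comm_group_Z2_pow)
  show ?thesis using assms
  proof (induction A)
    case empty
    have "\<one>\<^bsub>Z2_pow d\<^esub> = (\<lambda>j\<in>{..<d}. 0)" by (simp add: Z2_pow_def)
    then show ?case by simp
  next
    case (insert a A)
    have "(\<Otimes>\<^bsub>Z2_pow d\<^esub>i\<in>insert a A. g i) = g a \<otimes>\<^bsub>Z2_pow d\<^esub> (\<lambda>j\<in>{..<d}. (\<Sum>i\<in>A. g i j) mod 2)"
    proof -
      have "(\<Otimes>\<^bsub>Z2_pow d\<^esub>i\<in>A. g i) = (\<lambda>j\<in>{..<d}. (\<Sum>i\<in>A. g i j) mod 2)"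
        using insert by auto
      moreover have "(\<Otimes>\<^bsub>Z2_pow d\<^esub>i\<in>insert a A. g i) = g a \<otimes>\<^bsub>Z2_pow d\<^esub> (\<Otimes>\<^bsub>Z2_pow d\<^esub>i\<in>A. g i)"
        using insert by (intro finprod_insert) auto
      ultimately show ?thesis by (simp only:)
    qed
    also have "\<dots> = (\<lambda>j\<in>{..<d}. (\<Sum>i\<in>insert a A. g i j) mod 2)"
      using insert.hyps by (simp add: Z2_pow_def mod_add_right_eq cong: restrict_cong)
    finally show ?case .
  qed
qed

lemma zero_sum_on_iff:
  assumes xs: "seq_over (Z2_pow d) xs" and A: "A \<subseteq> {..<length xs}"
  shows "zero_sum_on (Z2_pow d) xs A \<longleftrightarrow> (\<forall>j<d. even (card (A \<inter> coord xs j)))"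
proof -
  have fin: "finite A" using A finite_subset by blast
  have car: "xs ! i \<in> carrier (Z2_pow d)" if "i \<in> A" for i
    using xs A that by (meson lessThan_iff nth_mem seq_over_def subsetD)
  have sum: "(\<Sum>i\<in>A. (xs ! i) j) = int (card (A \<inter> coord xs j))" if j: "j < d" for j
  proof -
    have "(\<Sum>i\<in>A. (xs ! i) j) = (\<Sum>i\<in>A. of_bool (i \<in> coord xs j))"
    proof (rule sum.cong[OF refl])
      fix i assume i: "i \<in> A"
      then have "(xs ! i) j \<in> {0, 1}" using car[OF i] j unfolding carrier_Z2_pow by (auto dest: PiE_mem)
      then show "(xs ! i) j = of_bool (i \<in> coord xs j)" using i A by (auto simp: coord_def)
    qed
    then show ?thesis using fin by simp
  qed
  have "zero_sum_on (Z2_pow d) xs A \<longleftrightarrow>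
      (\<lambda>j\<in>{..<d}. (\<Sum>i\<in>A. (xs ! i) j) mod 2) = (\<lambda>j\<in>{..<d}. 0)"
    unfolding zero_sum_on_def using car by (subst finprod_Z2_pow[OF fin]) (auto simp: Z2_pow_def)
  also have "\<dots> \<longleftrightarrow> (\<forall>j<d. (\<Sum>i\<in>A. (xs ! i) j) mod 2 = 0)"
    by (auto simp: fun_eq_iff restrict_def)
  also have "\<dots> \<longleftrightarrow> (\<forall>j<d. even (card (A \<inter> coord xs j)))"
    using sum by (auto simp: even_iff_mod_2_eq_zero[symmetric])
  finally show ?thesis .
qed

lemma has_zero_sum_subseq_iff:
  assumes "seq_over (Z2_pow d) xs"
  shows "has_zero_sum_subseq (Z2_pow d) r xs \<longleftrightarrow> hits (length xs) d r (coord xs)"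
  unfolding has_zero_sum_subseq_def hits_def using zero_sum_on_iff[OF assms] by blast

lemma zero_sum_seq_iff:
  assumes "seq_over (Z2_pow d) xs"
  shows "zero_sum_seq (Z2_pow d) xs \<longleftrightarrow> balanced (length xs) d (coord xs)"
  unfolding zero_sum_seq_def balanced_def using zero_sum_on_iff[OF assms] by blast

text \<open>
  Every family of sets comes from a sequence, up to what happens outside the first \<open>n\<close>
  positions and the first \<open>d\<close> sets.
\<close>

lemma exists_sequence:
  "\<exists>xs. seq_over (Z2_pow d) xs \<and> length xs = n
    \<and> (\<forall>r. hits n d r (coord xs) = hits n d r H) \<and> balanced n d (coord xs) = balanced n d H"
proof -
  define xs where "xs = map (\<lambda>i. \<lambda>j\<in>{..<d}. of_bool (i \<in> H j) :: int) [0..<n]"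
  have "seq_over (Z2_pow d) xs" by (auto simp: seq_over_def carrier_Z2_pow xs_def)
  moreover have "A \<inter> coord xs j = A \<inter> H j" if "A \<subseteq> {..<n}" "j < d" for A j
    using that by (auto simp: coord_def xs_def)
  then have eq: "(\<forall>j<d. even (card (A \<inter> coord xs j))) \<longleftrightarrow> (\<forall>j<d. even (card (A \<inter> H j)))"
    if "A \<subseteq> {..<n}" for A using that by simp
  have "(\<forall>r. hits n d r (coord xs) = hits n d r H) \<and> balanced n d (coord xs) = balanced n d H"
    unfolding hits_def balanced_def eq[OF subset_refl] by (simp add: eq cong: conj_cong)
  ultimately show ?thesis by (intro exI[of _ xs]) (simp add: xs_def)
qed

lemma egz_Z2_pow: "egz r (Z2_pow d) = (LEAST s. \<forall>H. hits s d r H)"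
proof -
  have "(\<forall>xs. seq_over (Z2_pow d) xs \<and> length xs = s \<longrightarrow> has_zero_sum_subseq (Z2_pow d) r xs)
      \<longleftrightarrow> (\<forall>H. hits s d r H)" for s
    using exists_sequence[of d s] has_zero_sum_subseq_iff by metis
  then show ?thesis by (simp add: egz_def)
qed

lemma egz_mod_Z2_pow:
  "egz_mod r (Z2_pow d) = (LEAST s. \<forall>n\<ge>s. \<forall>H. balanced n d H \<longrightarrow> hits n d r H)"
proof -
  have "(\<forall>xs. seq_over (Z2_pow d) xs \<and> zero_sum_seq (Z2_pow d) xs \<and> length xs \<ge> s
          \<longrightarrow> has_zero_sum_subseq (Z2_pow d) r xs)
      \<longleftrightarrow> (\<forall>n\<ge>s. \<forall>H. balanced n d H \<longrightarrow> hits n d r H)" for s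
    using exists_sequence[of d] has_zero_sum_subseq_iff zero_sum_seq_iff by metis
  then show ?thesis by (simp add: egz_mod_def)
qed

section \<open>The two constants\<close>

lemma egz_eqI:
  assumes "\<And>H. hits (Suc n) d r H" and "\<not> hits n d r Z"
  shows "egz r (Z2_pow d) = Suc n"
  unfolding egz_Z2_pow
proof (rule Least_equality)
  fix s assume "\<forall>H. hits s d r H"
  then have "\<not> s \<le> n" using assms(2) hits_mono by blast
  then show "Suc n \<le> s" by simp
qed (use assms(1) in blast)

lemma egz_mod_eqI:
  assumes "\<And>m H. m \<ge> Suc n \<Longrightarrow> balanced m d H \<Longrightarrow> hits m d r H"
    and "balanced n d Z" "\<not> hits n d r Z"
  shows "egz_mod r (Z2_pow d) = Suc n"
  unfolding egz_mod_Z2_pow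
proof (rule Least_equality)
  fix s assume "\<forall>m\<ge>s. \<forall>H. balanced m d H \<longrightarrow> hits m d r H"
  then have "\<not> s \<le> n" using assms(2,3) by blast
  then show "Suc n \<le> s" by simp
qed (use assms(1) in blast)

lemma egz_mod_eq_egz:
  assumes up: "\<And>H. hits (Suc n) d r H" and Z: "balanced n d Z" "\<not> hits n d r Z"
  shows "egz_mod r (Z2_pow d) = egz r (Z2_pow d)"
proof -
  have "egz_mod r (Z2_pow d) = Suc n"
    by (rule egz_mod_eqI[OF _ Z]) (rule hits_mono[OF up])
  then show ?thesis using egz_eqI[OF up Z(2)] by simp
qed

text \<open>
  A zero-sum bad sequence of length \<open>n\<close> is obtained from a bad sequence of length \<open>Suc n\<close> by
  dropping a term; the rest has odd length.
\<close>

lemma egz_mod_eq_egz_minus_one: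
  assumes up: "\<And>H. hits (Suc (Suc n)) d r H" and Z: "\<not> hits (Suc n) d r Z"
    and bal: "\<And>H. balanced (Suc n) d H \<Longrightarrow> hits (Suc n) d r H" and par: "odd n" "even r"
  shows "Suc (egz_mod r (Z2_pow d)) = egz r (Z2_pow d)"
proof -
  have "\<not> hits n d r Z" using Z hits_mono[of n d r Z "Suc n"] by auto
  then obtain Z' where Z': "balanced n d Z'" "\<not> hits n d r Z'" using not_hits_odd_length par by blast
  have "egz_mod r (Z2_pow d) = Suc n"
  proof (rule egz_mod_eqI[OF _ Z'])
    fix m H assume m: "Suc n \<le> m" and b: "balanced m d H"
    show "hits m d r H"
    proof (cases "m = Suc n")
      case False then show ?thesis using m hits_mono[OF up, of m] by simp
    qed (use bal b in simp)
  qed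
  then show ?thesis using egz_eqI[OF up Z] by simp
qed

text \<open>
  The complement of the sought set has \<open>d - 1\<close> elements. In the first two cases one uses
  \<open>k - 1\<close> and \<open>k - 2\<close> in place of \<open>k\<close>; in the last one \<open>(d - 1) div 2\<close>, for which the sequence
  is long enough for the bound in top rank.
\<close>

lemma balanced_hits:
  assumes d: "d \<ge> 1" "odd d"
    and cases: "d + 1 = 2 * k \<or> d + 3 = 2 * k \<and> even k \<or> d + 5 \<le> 2 * k"
    and H: "balanced (2 * k + d - 1) d H"
  shows "hits (2 * k + d - 1) d (2 * k) H"
  using cases
proof (elim disjE conjE)
  assume e: "d + 1 = 2 * k"
  then obtain h where h: "k = Suc h" by (cases k) auto
  have "2 * k + d - 1 = 4 * h + 2" "d = 2 * h + 1" "2 * k = 2 * h + 2" using e h by simp_all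
  then show ?thesis using balanced_hits_corank_one[of h H] H by simp
next
  assume e: "d + 3 = 2 * k" "even k"
  define h where "h = k - 2"
  have "k \<ge> 2" using e(1) d(1) by linarith
  then have h: "k = h + 2" "even h" using e(2) by (simp_all add: h_def)
  have n: "2 * k + d - 1 = 4 * h + 4" and dh: "d = 2 * h + 1" using e h by simp_all
  have "hits (4 * h + 4) d (2 * h) H"
    using hits_mono[OF hits_top_rank_even[OF h(2)], of "4 * h + 4" H] dh by simp
  then have "hits (4 * h + 4) d (4 * h + 4 - 2 * h) H"
    using H unfolding n by (rule hits_complement)
  moreover have "4 * h + 4 - 2 * h = 2 * k" using h by simp
  ultimately show ?thesis unfolding n by (simp only:)
next
  assume e: "d + 5 \<le> 2 * k"
  obtain h where h: "d = 2 * h + 1" using d(2) by (elim oddE)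
  have "hits (2 * k + d - 1) d (2 * h) H"
    using hits_mono[OF hits_top_rank[of h H], of "2 * k + d - 1"] e h by simp
  from hits_complement[OF this H] show ?thesis using h by simp
qed

theorem theorem2:
  fixes k d :: nat
  assumes "k \<ge> 1" and "d \<ge> 1" and "d \<le> 2 * k + 1"
  shows "if int d = 2 * int k - 1
            \<or> (int d = 2 * int k - 3 \<and> even k)
            \<or> (int d \<le> 2 * int k - 5 \<and> odd d)
         then int (egz_mod (2 * k) (Z2_pow d)) = int (egz (2 * k) (Z2_pow d)) - 1
         else egz_mod (2 * k) (Z2_pow d) = egz (2 * k) (Z2_pow d)"
proof -
  have small: "hits (Suc (2 * k + d - 1)) d (2 * k) H" if "d \<le> 2 * k - 1" for H
    using hits_small_rank[OF that assms(1), of H] assms(1) by simp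
  have small_bad: "\<not> hits (2 * k + d - 1) d (2 * k) (\<lambda>j. {2 * k - 1 + j})"
    by (rule not_hits_basis[OF assms(1)])
  show ?thesis
  proof (split if_split, intro conjI impI)
    assume c: "int d = 2 * int k - 1 \<or> (int d = 2 * int k - 3 \<and> even k)
      \<or> (int d \<le> 2 * int k - 5 \<and> odd d)"
    then have odd: "odd d" by presburger
    have cases: "d + 1 = 2 * k \<or> d + 3 = 2 * k \<and> even k \<or> d + 5 \<le> 2 * k" using c by linarith
    have dk: "d \<le> 2 * k - 1" using cases by linarith
    have n: "2 * k + d - 1 = Suc (2 * k + d - 2)" using assms by simp
    have "Suc (egz_mod (2 * k) (Z2_pow d)) = egz (2 * k) (Z2_pow d)"
    proof (rule egz_mod_eq_egz_minus_one)
      show "hits (Suc (Suc (2 * k + d - 2))) d (2 * k) H" for H using small[OF dk] n by simp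
      show "\<not> hits (Suc (2 * k + d - 2)) d (2 * k) (\<lambda>j. {2 * k - 1 + j})" using small_bad n by simp
      show "hits (Suc (2 * k + d - 2)) d (2 * k) H" if "balanced (Suc (2 * k + d - 2)) d H" for H
        using balanced_hits[OF assms(2) odd cases] that unfolding n by simp
      show "odd (2 * k + d - 2)" using odd assms by simp
    qed simp
    then show "int (egz_mod (2 * k) (Z2_pow d)) = int (egz (2 * k) (Z2_pow d)) - 1" by linarith
  next
    assume c: "\<not> (int d = 2 * int k - 1 \<or> (int d = 2 * int k - 3 \<and> even k)
      \<or> (int d \<le> 2 * int k - 5 \<and> odd d))"
    consider (small_even) "d \<le> 2 * k - 1" "even d" | (small_odd) "d + 3 = 2 * k" "odd k"
      | (mid) "d = 2 * k" | (top_even) "d = 2 * k + 1" "even k" | (top_odd) "d = 2 * k + 1" "odd k"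
    proof -
      have "d + 3 = 2 * k \<and> odd k" if "d \<le> 2 * k - 1" "odd d"
        using c that assms(1) by presburger
      moreover have "d \<le> 2 * k - 1 \<or> d = 2 * k \<or> d = 2 * k + 1" using assms(3) by linarith
      ultimately show ?thesis using that by blast
    qed
    then show "egz_mod (2 * k) (Z2_pow d) = egz (2 * k) (Z2_pow d)"
    proof cases
      case small_even
      have "odd (2 * k + d - 1)" using small_even assms by simp
      then obtain Z where "balanced (2 * k + d - 1) d Z" "\<not> hits (2 * k + d - 1) d (2 * k) Z"
        using not_hits_odd_length[OF small_bad] by auto
      then show ?thesis by (rule egz_mod_eq_egz[OF small[OF small_even(1)]])
    next
      case small_odd
      \<comment> \<open>Here \<open>d\<close> is \<open>N - 1\<close>, and \<open>N\<close> is divisible by four because \<open>k\<close> is odd.\<close>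
      define N where "N = 2 * k - 2"
      obtain m where m: "k = 2 * m + 1" using small_odd(2) by (elim oddE)
      have N: "4 dvd N" "N > 0" "2 * k \<noteq> N" "2 * N = 2 * k + d - 1" "N - 1 = d" "d \<le> 2 * k - 1"
        using small_odd m assms by (auto simp: N_def)
      show ?thesis
        using egz_mod_eq_egz[OF small[OF N(6)]] not_hits_doubly_even[OF N(1,2) small_odd(2) N(3)]
        unfolding N(4,5) by blast
    next
      case mid
      have "hits (Suc (4 * k)) d (2 * k) H" for H using hits_middle_rank[of k H] mid by simp
      from egz_mod_eq_egz[OF this] show ?thesis
        using not_hits_basis_sum[OF assms(1)] mid by blast
    next
      case top_even
      have up: "hits (Suc (4 * k + 1)) d (2 * k) H" for H
        using hits_top_rank_even[OF top_even(2), of H] top_even by simp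
      have "\<exists>Z. \<not> hits (4 * k + 1) d (2 * k) Z"
        using not_hits_Suc[OF not_hits_basis_sum(2)[OF assms(1)]] top_even by auto
      then obtain Z where "balanced (4 * k + 1) d Z" "\<not> hits (4 * k + 1) d (2 * k) Z"
        using not_hits_odd_length[of "4 * k + 1" d "2 * k"] by auto
      then show ?thesis by (rule egz_mod_eq_egz[OF up])
    next
      case top_odd
      have up: "hits (Suc (4 * k + 4)) d (2 * k) H" for H
        using hits_top_rank[of k H] top_odd by (simp add: numeral_eq_Suc)
      obtain m where "k = 2 * m + 1" using top_odd(2) by (elim oddE)
      then have "2 * k + 2 = 4 * (m + 1)" by simp
      then have N: "4 dvd 2 * k + 2" by (rule dvdI)
      have N': "2 * k + 2 > 0" "2 * k \<noteq> 2 * k + 2" by simp_all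
      have e: "2 * (2 * k + 2) = 4 * k + 4" "2 * k + 2 - 1 = d" using top_odd(1) by simp_all
      show ?thesis
        using egz_mod_eq_egz[OF up] not_hits_doubly_even[OF N N'(1) top_odd(2) N'(2)]
        unfolding e by blast
    qed
  qed
qed

end
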